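(* Suppose $P_1,P_2,P_3,P_4$ are pairwise disjoint and non-parallel planes in $\mathbb{H}^3$ such that for each $i$, a single half-space $H_i$ bounded by $P_i$ contains $P_j$ for all $j\ne i$, and let $\Delta$ be the truncated tetrahedron determined by the $P_i$. For any fixed $i<j\in\{1,2,3,4\}$ and $k<l\in\{1,2,3,4\}-\{i,j\}$, let $\tilde\lambda_{ij}$ be the geodesic intersecting $P_i$ and $P_j$ at right angles and $\tilde\lambda_{kl}$ the geodesic intersecting $P_k$ and $P_l$ at right angles. Fix parametrizations $\tilde\lambda_{ij}(s)$ and $\tilde\lambda_{kl}(t)$ by arclength. Then: \begin{enumerate} \item the function $D(s,t)$ that records the hyperbolic cosine of the distance from $\tilde\lambda_{ij}(s)$ to $\tilde\lambda_{kl}(t)$ has a unique critical point $(s_0,t_0)$ in $\mathbb{R}^2$, at which it attains an absolute minimum; \item the absolute minimum value $D(s_0,t_0)$ depends only on the pairwise distances $\ell_{i'j'}$ between $P_{i'}$ and $P_{j'}$, for $i'\ne j'\in\{1,2,3,4\}$; \item the points $\tilde\lambda_{ij}(s_0)$ and $\tilde\lambda_{kl}(t_0)$ lie in $\Delta$, so $D(s_0,t_0)$ is the hyperbolic cosine of a transversal length of $\Delta$ (that of the transversal joining the internal edges $\lambda_{ij}$ and $\lambda_{kl}$); and \item written as $T(x,y;a,b,c,d)$, where $x=\cosh\ell(\lambda_{ij})$, $y=\cosh\ell(\lambda_{kl})$, and $a,b,c,d$ are the hyperbolic cosines of the other four internal edge lengths of $\Delta$ (those of $\lambda_{ik}$,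 $\lambda_{il}$, $\lambda_{jk}$, $\lambda_{jl}$ respectively), this transversal length is invariant under even involutions of $\{a,b,c,d\}$ (i.e. products of two disjoint transpositions of these inputs), and strictly increasing in each of these variables, for any fixed $x,y>1$. \end{enumerate}
   Context: A plane in $\mathbb{H}^3$ is a two-dimensional totally geodesic copy of $\mathbb{H}^2$. A half-space is the closure of one component of the complement of a plane (its boundary plane). Two disjoint planes are parallel if their ideal boundaries intersect; so pairwise disjoint and non-parallel planes are at positive distance, attained along a unique common perpendicular arc. Truncated tetrahedron. Let $P_1,\dots,P_4$ and $H_1,\dots,H_4$ be as in the claim. For each $i$ there is a unique plane $\widehat P_i$ that meets $P_j$ at right angles for every $j\ne i$. If $\widehat P_i$ does not meet $P_i$ orthogonally for some (hence every) $i$, then for each $i$ there is a single half-space $\widehat H_i$ bounded by $\widehat P_i$ containing the shortest geodesic arc from $P_j$ to $P_i$ for all $j\neq i$, and the truncated tetrahedron determined by the $P_i$ is $\Delta=\left(\bigcap_{i=1}^4 H_i\right)\cap\left(\bigcap_{i=1}^4\widehat H_i\right)$. Otherwise all $\widehat P_i$ equal a single plane $\widehat P$ orthogonal to every $P_i$; then, after renumbering so that the perpendicular geodesic to $P_1$ and $P_3$ separates $P_2\cap\widehat P$ from $P_4\cap\widehat P$, the (degenerate) truncated tetrahedron is $\Delta=\widehat P\cap\left(\bigcap_{i=1}^4 H_i\right)\cap h_{12}\cap h_{23}\cap h_{34}\cap h_{14}$, where $h_{12}$ is the half-plane of $\widehat P$ bounded by the perpendicular geodesic to $P_1$ and $P_2$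 that contains $P_3\cap\widehat P$ and $P_4\cap\widehat P$, and $h_{23},h_{34},h_{14}$ are defined analogously. For $i'\neq j'$ the internal edge $\lambda_{i'j'}=\lambda_{j'i'}$ is the shortest arc in $\mathbb{H}^3$ joining $P_{i'}$ to $P_{j'}$, and $\ell(\lambda_{i'j'})=\ell_{i'j'}$ is its length. The internal edge opposite $\lambda_{ij}$ is $\lambda_{kl}$ where $\{k,l\}=\{1,2,3,4\}-\{i,j\}$. The transversal of $\Delta$ joining $\lambda_{ij}$ to its opposite $\lambda_{kl}$ is the shortest geodesic arc with one endpoint on each of the two edges, or, if these edges intersect, their point of intersection (so its length is $0$); a transversal length is the length of a transversal. $T$ is a function on the tuples $(x,y;a,b,c,d)$ realized by such configurations. *)

theory Defs
  imports "HOL-Analysis.Analysis"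
begin

text \<open>Hyperbolic 3-space is realised as the upper sheet of the hyperboloid in Minkowski space
  \<open>\<real>\<^sup>3 \<times> \<real>\<close>. The Riemannian metric is the restriction of the Lorentz form to tangent spaces.\<close>

type_synonym minkowski = "(real^3) \<times> real"

definition lorentz :: "minkowski \<Rightarrow> minkowski \<Rightarrow> real" where
  "lorentz x y = fst x \<bullet> fst y - snd x * snd y"

definition H3 :: "minkowski set" where
  "H3 = {x. lorentz x x = -1 \<and> snd x > 0}"

definition hdist :: "minkowski \<Rightarrow> minkowski \<Rightarrow> real" where
  "hdist x y = arcosh (- lorentz x y)"

definition hset_dist :: "minkowski set \<Rightarrow> minkowski set \<Rightarrow> real" where
  "hset_dist A B = Inf {hdist x y | x y. x \<in> A \<and> y \<in> B}"

text \<open>A nonempty intersection with an \<open>(m+1)\<close>-dimensional linear subspace is a totally geodesic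
  copy of hyperbolic \<open>m\<close>-space, and all of them arise in this way.\<close>

definition hyp_subspace :: "nat \<Rightarrow> minkowski set \<Rightarrow> bool" where
  "hyp_subspace m S \<longleftrightarrow> S \<noteq> {} \<and> (\<exists>V. subspace V \<and> dim V = m + 1 \<and> S = V \<inter> H3)"

abbreviation hplane :: "minkowski set \<Rightarrow> bool" where
  "hplane \<equiv> hyp_subspace 2"

abbreviation geodesic :: "minkowski set \<Rightarrow> bool" where
  "geodesic \<equiv> hyp_subspace 1"

definition arclength_parametrization :: "minkowski set \<Rightarrow> (real \<Rightarrow> minkowski) \<Rightarrow> bool" where
  "arclength_parametrization L \<gamma> \<longleftrightarrow>
     range \<gamma> = L \<and> (\<forall>s t. hdist (\<gamma> s) (\<gamma> t) = \<bar>s - t\<bar>)"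

definition hsegment :: "minkowski \<Rightarrow> minkowski \<Rightarrow> minkowski set" where
  "hsegment x y = {z \<in> H3. hdist x z + hdist z y = hdist x y}"

text \<open>The segment from \<open>x\<close> to \<open>y\<close> is a shortest arc from \<open>A\<close> to \<open>B\<close>. The degenerate case \<open>x = y\<close>
  occurs exactly when \<open>A\<close> and \<open>B\<close> (subsets of \<open>H3\<close>) meet.\<close>

definition shortest_arc ::
  "minkowski set \<Rightarrow> minkowski set \<Rightarrow> minkowski \<Rightarrow> minkowski \<Rightarrow> bool" where
  "shortest_arc A B x y \<longleftrightarrow>
     x \<in> A \<and> y \<in> B \<and> (\<forall>x'\<in>A. \<forall>y'\<in>B. hdist x y \<le> hdist x' y')"

text \<open>\<open>half X Y H\<close>: \<open>H\<close> is a half of \<open>X\<close> bounded by \<open>Y\<close>. It is used for half-spaces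
  (\<open>X = H3\<close>, \<open>Y\<close> a plane) and half-planes (\<open>X\<close> a plane, \<open>Y\<close> a geodesic in \<open>X\<close>). Such an \<open>X\<close> is
  closed in the ambient space, so the ambient closure is the closure in \<open>X\<close>.\<close>

definition half :: "minkowski set \<Rightarrow> minkowski set \<Rightarrow> minkowski set \<Rightarrow> bool" where
  "half X Y H \<longleftrightarrow> (\<exists>C \<in> components (X - Y). H = closure C)"

definition separates ::
  "minkowski set \<Rightarrow> minkowski set \<Rightarrow> minkowski set \<Rightarrow> minkowski set \<Rightarrow> bool" where
  "separates X Y A B \<longleftrightarrow>
     (\<exists>C \<in> components (X - Y). \<exists>D \<in> components (X - Y). C \<noteq> D \<and> A \<subseteq> C \<and> B \<subseteq> D)"

text \<open>The sphere at infinity consists of the light-like rays, each normalised to last coordinate 1;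
  a set is compactified through its image in the projective (Klein) model.\<close>

definition ideal_boundary :: "minkowski set \<Rightarrow> minkowski set" where
  "ideal_boundary S = closure ((\<lambda>x. (1 / snd x) *\<^sub>R x) ` S) \<inter> {u. lorentz u u = 0}"

definition parallel :: "minkowski set \<Rightarrow> minkowski set \<Rightarrow> bool" where
  "parallel P Q \<longleftrightarrow> P \<inter> Q = {} \<and> ideal_boundary P \<inter> ideal_boundary Q \<noteq> {}"

definition tangent_vectors :: "minkowski set \<Rightarrow> minkowski \<Rightarrow> minkowski set" where
  "tangent_vectors S p =
     {v. \<exists>c :: real \<Rightarrow> minkowski.
           (\<forall>t. c t \<in> S) \<and> c 0 = p \<and> (c has_vector_derivative v) (at 0)}"

definition normal_vectors :: "minkowski set \<Rightarrow> minkowski \<Rightarrow> minkowski set" where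
  "normal_vectors S p =
     {u \<in> tangent_vectors H3 p. \<forall>v \<in> tangent_vectors S p. lorentz u v = 0}"

definition line_perp_plane :: "minkowski set \<Rightarrow> minkowski set \<Rightarrow> bool" where
  "line_perp_plane L P \<longleftrightarrow> L \<inter> P \<noteq> {} \<and>
     (\<forall>p \<in> L \<inter> P. \<forall>u \<in> tangent_vectors L p. \<forall>v \<in> tangent_vectors P p. lorentz u v = 0)"

text \<open>Two planes meet at right angles when their normals at the common points are orthogonal
  (their tangent planes themselves share a direction).\<close>

definition planes_perp :: "minkowski set \<Rightarrow> minkowski set \<Rightarrow> bool" where
  "planes_perp P Q \<longleftrightarrow> P \<inter> Q \<noteq> {} \<and>
     (\<forall>p \<in> P \<inter> Q. \<forall>u \<in> normal_vectors P p. \<forall>v \<in> normal_vectors Q p. lorentz u v = 0)"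

definition common_perpendicular ::
  "minkowski set \<Rightarrow> minkowski set \<Rightarrow> minkowski set \<Rightarrow> bool" where
  "common_perpendicular P Q L \<longleftrightarrow> geodesic L \<and> line_perp_plane L P \<and> line_perp_plane L Q"

definition admissible :: "(nat \<Rightarrow> minkowski set) \<Rightarrow> (nat \<Rightarrow> minkowski set) \<Rightarrow> bool" where
  "admissible P H \<longleftrightarrow>
     (\<forall>i\<in>{1..4}. hplane (P i) \<and> half H3 (P i) (H i) \<and>
        (\<forall>j\<in>{1..4} - {i}. P i \<inter> P j = {} \<and> \<not> parallel (P i) (P j) \<and> P j \<subseteq> H i))"

definition edge_length :: "(nat \<Rightarrow> minkowski set) \<Rightarrow> nat \<Rightarrow> nat \<Rightarrow> real" where
  "edge_length P i j = hset_dist (P i) (P j)"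

text \<open>For disjoint non-parallel planes the shortest arc is unique, so this is that arc.\<close>

definition internal_edge :: "(nat \<Rightarrow> minkowski set) \<Rightarrow> nat \<Rightarrow> nat \<Rightarrow> minkowski set" where
  "internal_edge P i j = {z. \<exists>x y. shortest_arc (P i) (P j) x y \<and> z \<in> hsegment x y}"

text \<open>\<open>edge_half_plane Q A B C D h\<close>: \<open>h\<close> is the half-plane of \<open>Q\<close> bounded by the common
  perpendicular geodesic to \<open>A\<close> and \<open>B\<close> that contains \<open>C \<inter> Q\<close> and \<open>D \<inter> Q\<close>.\<close>

definition edge_half_plane ::
  "minkowski set \<Rightarrow> minkowski set \<Rightarrow> minkowski set \<Rightarrow> minkowski set \<Rightarrow> minkowski set
     \<Rightarrow> minkowski set \<Rightarrow> bool" where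
  "edge_half_plane Q A B C D h \<longleftrightarrow>
     (\<exists>L. common_perpendicular A B L \<and> half Q L h) \<and> C \<inter> Q \<subseteq> h \<and> D \<inter> Q \<subseteq> h"

definition nondegenerate_tetrahedron ::
  "(nat \<Rightarrow> minkowski set) \<Rightarrow> (nat \<Rightarrow> minkowski set) \<Rightarrow> (nat \<Rightarrow> minkowski set)
     \<Rightarrow> minkowski set \<Rightarrow> bool" where
  "nondegenerate_tetrahedron P H P_hat \<Delta> \<longleftrightarrow>
     (\<exists>H_hat. (\<forall>i\<in>{1..4}. half H3 (P_hat i) (H_hat i) \<and>
                 (\<forall>j\<in>{1..4} - {i}. internal_edge P j i \<subseteq> H_hat i)) \<and>
        \<Delta> = (\<Inter>i\<in>{1..4}. H i) \<inter> (\<Inter>i\<in>{1..4}. H_hat i))"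

text \<open>The bijection \<open>r\<close> is the renumbering of the planes.\<close>

definition degenerate_tetrahedron ::
  "(nat \<Rightarrow> minkowski set) \<Rightarrow> (nat \<Rightarrow> minkowski set) \<Rightarrow> minkowski set
     \<Rightarrow> minkowski set \<Rightarrow> bool" where
  "degenerate_tetrahedron P H Q \<Delta> \<longleftrightarrow>
     (\<exists>r :: nat \<Rightarrow> nat. bij_betw r {1..4} {1..4} \<and>
        (let p = (\<lambda>i. P (r i)) in
          (\<exists>L. common_perpendicular (p 1) (p 3) L \<and> separates Q L (p 2 \<inter> Q) (p 4 \<inter> Q)) \<and>
          (\<exists>h12 h23 h34 h14.
             edge_half_plane Q (p 1) (p 2) (p 3) (p 4) h12 \<and>
             edge_half_plane Q (p 2) (p 3) (p 1) (p 4) h23 \<and>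
             edge_half_plane Q (p 3) (p 4) (p 1) (p 2) h34 \<and>
             edge_half_plane Q (p 1) (p 4) (p 2) (p 3) h14 \<and>
             \<Delta> = Q \<inter> (\<Inter>i\<in>{1..4}. H i) \<inter> h12 \<inter> h23 \<inter> h34 \<inter> h14)))"

text \<open>\<open>\<Delta>\<close> is the truncated tetrahedron determined by an admissible configuration. Under
  admissibility the plane \<open>P_hat i\<close> is unique.\<close>

definition truncated_tetrahedron ::
  "(nat \<Rightarrow> minkowski set) \<Rightarrow> (nat \<Rightarrow> minkowski set) \<Rightarrow> minkowski set \<Rightarrow> bool" where
  "truncated_tetrahedron P H \<Delta> \<longleftrightarrow>
     (\<exists>P_hat. (\<forall>i\<in>{1..4}. hplane (P_hat i) \<and>
                 (\<forall>j\<in>{1..4} - {i}. planes_perp (P_hat i) (P j))) \<and>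
        (if \<exists>i\<in>{1..4}. \<not> planes_perp (P_hat i) (P i)
         then nondegenerate_tetrahedron P H P_hat \<Delta>
         else \<exists>Q. (\<forall>i\<in>{1..4}. P_hat i = Q) \<and> degenerate_tetrahedron P H Q \<Delta>))"

text \<open>\<open>is_transversal P i j k l x y\<close>: the segment from \<open>x\<close> to \<open>y\<close> is the transversal joining the
  edges \<open>ij\<close> and \<open>kl\<close>; it is a single point \<open>x = y\<close> if these edges intersect.\<close>

definition is_transversal ::
  "(nat \<Rightarrow> minkowski set) \<Rightarrow> nat \<Rightarrow> nat \<Rightarrow> nat \<Rightarrow> nat \<Rightarrow> minkowski \<Rightarrow> minkowski \<Rightarrow> bool" where
  "is_transversal P i j k l x y \<longleftrightarrow>
     shortest_arc (internal_edge P i j) (internal_edge P k l) x y"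

definition transversal_length ::
  "(nat \<Rightarrow> minkowski set) \<Rightarrow> nat \<Rightarrow> nat \<Rightarrow> nat \<Rightarrow> nat \<Rightarrow> real" where
  "transversal_length P i j k l = hset_dist (internal_edge P i j) (internal_edge P k l)"

definition opposite_indices :: "nat \<Rightarrow> nat \<Rightarrow> nat \<Rightarrow> nat \<Rightarrow> bool" where
  "opposite_indices i j k l \<longleftrightarrow>
     i \<in> {1..4} \<and> j \<in> {1..4} \<and> i < j \<and>
     k \<in> {1..4} - {i, j} \<and> l \<in> {1..4} - {i, j} \<and> k < l"

text \<open>The tuples \<open>(x, y, a, b, c, d)\<close> realised by admissible configurations: the domain of the
  transversal length function.\<close>

definition realized :: "(real \<times> real \<times> real \<times> real \<times> real \<times> real) set" where
  "realized =
     {(cosh (edge_length P i j), cosh (edge_length P k l),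
       cosh (edge_length P i k), cosh (edge_length P i l),
       cosh (edge_length P j k), cosh (edge_length P j l)) | P H i j k l.
        admissible P H \<and> opposite_indices i j k l}"

definition critical_point :: "(real \<times> real \<Rightarrow> real) \<Rightarrow> real \<times> real \<Rightarrow> bool" where
  "critical_point f z \<longleftrightarrow> (f has_derivative (\<lambda>_. 0)) (at z)"

end

theory Submission
  imports Defs
begin

text \<open>Write the planes as orthogonal complements of unit spacelike vectors \<open>n\<^sub>1, \<dots>, n\<^sub>4\<close> pointing out of
  the half-spaces, so that \<open>\<langle>n\<^sub>i, n\<^sub>j\<rangle> = - cosh \<ell>\<^sub>i\<^sub>j < - 1\<close>. The common perpendicular of two planes,
  parametrized by arclength from its midpoint, is
  \<open>(cosh (s - \<ell>/2) n\<^sub>i + cosh (s + \<ell>/2) n\<^sub>j) / sinh \<ell>\<close>. Hence \<open>D(s, t)\<close> is a combination of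
  \<open>exp (\<plusminus> s \<plusminus> t)\<close> whose four coefficients are explicit positive combinations of \<open>a, b, c, d\<close>.
  The arithmetic-geometric mean inequality in \<open>s + t\<close> and in \<open>s - t\<close> gives the unique critical point,
  and the minimum in closed form, from which symmetry and monotonicity are read off. Comparing the
  coefficients shows that the critical point lies on the internal edges. These consist of positive
  combinations of two normals and therefore lie in \<open>\<Delta>\<close>, also in the degenerate case.\<close>

section \<open>Lorentz geometry of the hyperboloid\<close>

text \<open>Write h, k for half the lengths of the two edges. Measuring from the midpoints makes the
  four coefficients values E(+-h, +-k) of one positive function, up to a common factor. This serves
  three ends. Exchanging the ends of an edge only flips the sign of h or k, which exchanges the two
  radicands of the minimum. Raising a, b, c or d raises all four values. Flipping the sign of h
  changes E by a factor of at most e^(2h), which confines the critical parameters to [-h, h] and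
  [-k, k]. For fixed x, y > 1 the closed formula increases on all positive inputs, so two realized
  tuples are compared directly, without a path of configurations between them. The geometric work is
  to extract unit normals and linear inequalities from notions phrased by components, closures,
  ideal points and tangent vectors. The signs are delicate: the half-spaces must force products
  below -1 and a future-directed sum of any two normals, so that the edges lie on the upper
  sheet.\<close>

lemma lorentz_commute: "lorentz x y = lorentz y x"
  by (simp add: lorentz_def inner_commute)

lemma lorentz_add_left: "lorentz (x + y) z = lorentz x z + lorentz y z"
  and lorentz_add_right: "lorentz z (x + y) = lorentz z x + lorentz z y"
  and lorentz_diff_left: "lorentz (x - y) z = lorentz x z - lorentz y z"
  and lorentz_diff_right: "lorentz z (x - y) = lorentz z x - lorentz z y"
  and lorentz_minus_left: "lorentz (- x) z = - lorentz x z"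
  and lorentz_minus_right: "lorentz z (- x) = - lorentz z x"
  and lorentz_scaleR_left: "lorentz (r *\<^sub>R x) z = r * lorentz x z"
  and lorentz_scaleR_right: "lorentz z (r *\<^sub>R x) = r * lorentz z x"
  and lorentz_zero_left: "lorentz 0 z = 0"
  and lorentz_zero_right: "lorentz z 0 = 0"
  by (simp_all add: lorentz_def algebra_simps inner_simps)

lemmas lorentz_simps = lorentz_add_left lorentz_add_right lorentz_diff_left lorentz_diff_right
  lorentz_minus_left lorentz_minus_right lorentz_scaleR_left lorentz_scaleR_right
  lorentz_zero_left lorentz_zero_right

lemma bounded_linear_lorentz_right: "bounded_linear (\<lambda>x. lorentz x n)"
proof -
  have "(\<lambda>x. lorentz x n) = (\<lambda>x. x \<bullet> (fst n, - snd n))"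
    by (auto simp: lorentz_def inner_prod_def)
  then show ?thesis by (simp add: bounded_linear_inner_left)
qed

lemma continuous_on_lorentz [continuous_intros]:
  assumes "continuous_on S f" "continuous_on S g"
  shows "continuous_on S (\<lambda>x. lorentz (f x) (g x))"
  unfolding lorentz_def by (intro continuous_intros assms)

lemma norm_fst_H3:
  assumes "p \<in> H3"
  shows "(snd p)\<^sup>2 = 1 + (norm (fst p))\<^sup>2" "norm (fst p) < snd p"
proof -
  show *: "(snd p)\<^sup>2 = 1 + (norm (fst p))\<^sup>2"
    using assms unfolding power2_norm_eq_inner by (simp add: H3_def lorentz_def power2_eq_square)
  show "norm (fst p) < snd p"
    by (rule power2_less_imp_less) (use * assms in \<open>simp_all add: H3_def\<close>)
qed

text \<open>Reverse Cauchy-Schwarz inequality: for the norms a, b of the space parts, (1 + a^2)(1 +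
  b^2) - (1 + a b)^2 = (a - b)^2.\<close>

lemma H3_lorentz_le:
  assumes "x \<in> H3" "y \<in> H3"
  shows "lorentz x y \<le> - 1"
proof -
  let ?a = "norm (fst x)" and ?b = "norm (fst y)"
  have x: "(snd x)\<^sup>2 = 1 + ?a\<^sup>2" "snd x > 0" and y: "(snd y)\<^sup>2 = 1 + ?b\<^sup>2" "snd y > 0"
    using norm_fst_H3 assms by (auto simp: H3_def)
  have "(1 + ?a * ?b)\<^sup>2 \<le> (snd x * snd y)\<^sup>2"
    unfolding power_mult_distrib x y using zero_le_power2[of "?a - ?b"]
    by (simp add: power2_eq_square algebra_simps)
  then have "1 + ?a * ?b \<le> snd x * snd y"
    by (rule power2_le_imp_le) (use x y in simp)
  moreover have "fst x \<bullet> fst y \<le> ?a * ?b" by (rule norm_cauchy_schwarz)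
  ultimately show ?thesis by (simp add: lorentz_def)
qed

text \<open>The orthogonal complement of a timelike vector is positive definite: as
  \<open>norm (fst p) < snd p\<close>, orthogonality to \<open>p\<close> bounds the time part of
  \<open>v\<close> by its space part. The rigidity arguments below rest on the second claim.\<close>

lemma lorentz_orthogonal_nonneg:
  assumes "p \<in> H3" "lorentz v p = 0"
  shows "lorentz v v \<ge> 0" "lorentz v v = 0 \<Longrightarrow> v = 0"
proof -
  let ?a = "norm (fst v)" and ?b = "norm (fst p)"
  have p: "?b < snd p" "0 < snd p" using norm_fst_H3 assms by (auto simp: H3_def)
  have "\<bar>snd v\<bar> * snd p = \<bar>fst v \<bullet> fst p\<bar>"
    using assms p by (simp add: lorentz_def abs_mult)
  also have "\<dots> \<le> ?a * ?b" by (rule Cauchy_Schwarz_ineq2)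
  finally have le: "\<bar>snd v\<bar> * snd p \<le> ?a * ?b" .
  have "?a * ?b \<le> ?a * snd p" using p by (intro mult_left_mono) auto
  with le have "\<bar>snd v\<bar> * snd p \<le> ?a * snd p" by linarith
  then have 1: "\<bar>snd v\<bar> \<le> ?a" using p by simp
  have eq: "lorentz v v = ?a\<^sup>2 - \<bar>snd v\<bar>\<^sup>2"
    unfolding power2_norm_eq_inner by (simp add: lorentz_def power2_eq_square)
  show "lorentz v v \<ge> 0" unfolding eq using 1 by (simp add: power2_le_iff_abs_le)
  assume "lorentz v v = 0"
  then have "\<bar>snd v\<bar>\<^sup>2 = ?a\<^sup>2" using eq by linarith
  then have e: "\<bar>snd v\<bar> = ?a" by (rule power2_eq_imp_eq) auto
  have "?a = 0"
  proof (rule ccontr)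
    assume "?a \<noteq> 0"
    then have "?a * ?b < ?a * snd p" using p by simp
    with le e show False by simp
  qed
  with e show "v = 0" by (simp add: prod_eq_iff)
qed

text \<open>The classical proof works on the positive definite complement of \<open>p\<close>:
  \<open>?x\<close> is a multiple of the component of \<open>v\<close> orthogonal to
  \<open>w\<close>.\<close>

lemma lorentz_Cauchy_Schwarz:
  assumes "p \<in> H3" "lorentz v p = 0" "lorentz w p = 0"
  shows "(lorentz v w)\<^sup>2 \<le> lorentz v v * lorentz w w"
proof (cases "lorentz w w = 0")
  case True
  then have "w = 0" using lorentz_orthogonal_nonneg assms by blast
  then show ?thesis by (simp add: lorentz_simps)
next
  case False
  define C where "C = lorentz w w"
  have C: "C > 0" using False lorentz_orthogonal_nonneg(1)[OF assms(1,3)] by (simp add: C_def)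
  define B where "B = lorentz v w"
  let ?x = "C *\<^sub>R v - B *\<^sub>R w"
  have "lorentz ?x p = 0" using assms by (simp add: lorentz_simps)
  then have "0 \<le> lorentz ?x ?x" using lorentz_orthogonal_nonneg assms by blast
  also have "lorentz ?x ?x = C * (C * lorentz v v - B\<^sup>2)"
    by (simp add: lorentz_simps C_def B_def lorentz_commute[of w v] power2_eq_square algebra_simps)
  finally have "0 \<le> C * lorentz v v - B\<^sup>2" using C by (simp add: zero_le_mult_iff)
  then show ?thesis by (simp add: B_def C_def mult.commute)
qed

section \<open>Radial projection to the hyperboloid and time orientation\<close>

definition normalize_H3 :: "minkowski \<Rightarrow> minkowski" where
  "normalize_H3 x = (1 / sqrt (- lorentz x x)) *\<^sub>R x"

lemma normalize_H3_in:
  assumes "lorentz x x < 0" "snd x > 0"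
  shows "normalize_H3 x \<in> H3"
proof -
  have "lorentz x x / (sqrt (- lorentz x x) * sqrt (- lorentz x x)) = -1"
    using assms by simp
  then show ?thesis using assms by (simp add: normalize_H3_def H3_def lorentz_simps)
qed

lemma normalize_H3_id: "x \<in> H3 \<Longrightarrow> normalize_H3 x = x"
  by (simp add: normalize_H3_def H3_def)

lemma timelike_snd_nonzero: "lorentz x x < 0 \<Longrightarrow> snd x \<noteq> 0"
  by (auto simp: lorentz_def not_less inner_ge_zero[THEN leD])

text \<open>Tests the sheet by the product with one reference point instead of the last coordinate,
  which is what Lorentz computations provide. A past-directed \<open>x\<close> is handled through
  \<open>- x\<close>.\<close>

lemma timelike_future_iff:
  assumes "p \<in> H3" "lorentz x x < 0"
  shows "snd x > 0 \<longleftrightarrow> lorentz x p < 0"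
proof -
  have *: "lorentz y p < 0" if "lorentz y y < 0" "snd y > 0" for y
  proof -
    have "lorentz (normalize_H3 y) p \<le> -1"
      using H3_lorentz_le normalize_H3_in that assms by blast
    then have "lorentz y p / sqrt (- lorentz y y) < 0"
      by (simp add: normalize_H3_def lorentz_simps)
    then show ?thesis using that by (simp add: divide_less_0_iff)
  qed
  show ?thesis
  proof
    assume l: "lorentz x p < 0"
    show "snd x > 0"
    proof (rule ccontr)
      assume "\<not> snd x > 0"
      then have "snd (- x) > 0" using timelike_snd_nonzero[OF assms(2)] by simp
      then have "lorentz (-x) p < 0" using *[of "- x"] assms by (simp add: lorentz_simps)
      with l show False by (simp add: lorentz_simps)
    qed
  qed (use * assms in blast)
qed

lemma in_H3_iff:
  assumes "p \<in> H3"
  shows "x \<in> H3 \<longleftrightarrow> lorentz x x = -1 \<and> lorentz x p < 0"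
  using timelike_future_iff[OF assms, of x] by (auto simp: H3_def)

lemma cosh_hdist:
  assumes "x \<in> H3" "y \<in> H3"
  shows "cosh (hdist x y) = - lorentz x y"
  using H3_lorentz_le[OF assms] by (simp add: hdist_def cosh_arcosh_real)

lemma hdist_nonneg: "x \<in> H3 \<Longrightarrow> y \<in> H3 \<Longrightarrow> 0 \<le> hdist x y"
  using H3_lorentz_le[of x y] by (simp add: hdist_def arcosh_nonneg_real)

lemma hdist_le_iff:
  assumes "x \<in> H3" "y \<in> H3" "x' \<in> H3" "y' \<in> H3"
  shows "hdist x y \<le> hdist x' y' \<longleftrightarrow> - lorentz x y \<le> - lorentz x' y'"
  using cosh_real_nonneg_le_iff[OF hdist_nonneg[OF assms(1,2)] hdist_nonneg[OF assms(3,4)]]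
  by (simp add: cosh_hdist assms)

text \<open>Equality in the triangle inequality forces the middle point into the plane spanned by the
  endpoints, because it is equality in the Cauchy-Schwarz inequality on the tangent space.\<close>

lemma hsegment_in_span:
  assumes "u \<in> H3" "v \<in> H3" "u \<noteq> v" "z \<in> hsegment u v"
  shows "z \<in> span {u, v}"
proof -
  have z: "z \<in> H3" and eq: "hdist u z + hdist z v = hdist u v"
    using assms by (auto simp: hsegment_def)
  define d e where "d = hdist u z" and "e = hdist z v"
  have cd: "cosh d = - lorentz u z" and ce: "cosh e = - lorentz z v"
    and cde: "cosh (d + e) = - lorentz u v"
    using cosh_hdist assms z eq by (auto simp: d_def e_def)
  have de: "0 \<le> d" "0 \<le> e" using hdist_nonneg assms z by (auto simp: d_def e_def)
  have ls: "lorentz u u = -1" "lorentz v v = -1" "lorentz z z = -1"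
    using assms z by (auto simp: H3_def)
  have "d + e \<noteq> 0"
  proof
    assume "d + e = 0"
    then have "lorentz u v = -1" using cde by simp
    then have 0: "lorentz (u - v) u = 0" "lorentz (u - v) (u - v) = 0"
      using ls by (simp_all add: lorentz_simps lorentz_commute[of v u])
    then show False using lorentz_orthogonal_nonneg(2)[OF assms(1) 0] assms(3) by simp
  qed
  then have pos: "sinh (d + e) > 0" using de by simp
  define w where "w = sinh e *\<^sub>R u + sinh d *\<^sub>R v - sinh (d + e) *\<^sub>R z"
  have l: "lorentz u z = - cosh d" "lorentz z u = - cosh d" "lorentz z v = - cosh e"
    "lorentz v z = - cosh e" "lorentz u v = - cosh (d + e)" "lorentz v u = - cosh (d + e)"
    using cd ce cde lorentz_commute by auto
  have wz: "lorentz w z = 0"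
    by (simp add: w_def lorentz_simps l ls sinh_add algebra_simps)
  have "lorentz w w = lorentz w u * sinh e + lorentz w v * sinh d - lorentz w z * sinh (d + e)"
    by (subst (2) w_def) (simp add: lorentz_simps mult.commute)
  also have "\<dots> = 0"
  proof -
    have "cosh d ^ 2 = 1 + sinh d ^ 2" "cosh e ^ 2 = 1 + sinh e ^ 2"
      by (simp_all add: cosh_square_eq)
    then show ?thesis
      unfolding wz by (simp add: w_def lorentz_simps l ls sinh_add cosh_add) algebra
  qed
  finally have "w = 0" using lorentz_orthogonal_nonneg(2) wz z by blast
  then have "z = (1 / sinh (d + e)) *\<^sub>R (sinh e *\<^sub>R u + sinh d *\<^sub>R v)"
    using pos by (simp add: w_def)
  moreover have "\<dots> \<in> span {u, v}"
    by (intro span_mul span_add) (simp_all add: span_base)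
  ultimately show ?thesis by simp
qed

lemma subspace_eq_kernel:
  fixes V W :: "'a::euclidean_space set"
  assumes "subspace V" "subspace W" "W \<subseteq> V" "dim V = dim W + 1"
  obtains w where "w \<noteq> 0" "W = {x \<in> V. w \<bullet> x = 0}"
proof -
  have "span W \<subset> span V"
    using assms by (auto simp: span_eq_iff[THEN iffD2] psubset_eq)
  then obtain w where w: "w \<noteq> 0" "w \<in> span V" "\<And>y. y \<in> span W \<Longrightarrow> orthogonal w y"
    using orthogonal_to_subspace_exists_gen by blast
  define U where "U = {x \<in> V. w \<bullet> x = 0}"
  have sU: "subspace U"
    using assms(1) unfolding U_def subspace_def by (auto simp: inner_simps)
  have "w \<in> V" using w assms by (metis span_eq_iff)
  moreover have "w \<notin> U" using w by (simp add: U_def)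
  moreover have "U \<subseteq> V" by (auto simp: U_def)
  ultimately have "span U \<subset> span V"
    using sU assms(1) by (auto simp: span_eq_iff[THEN iffD2])
  then have "dim U < dim V" by (rule dim_psubset)
  moreover have "W \<subseteq> U"
    using assms w by (auto simp: U_def orthogonal_def span_base)
  ultimately have "W = U"
    using assms sU by (intro subspace_dim_equal) auto
  with w show thesis by (intro that[of w]) (auto simp: U_def)
qed

section \<open>Half-spaces and tangent vectors\<close>

text \<open>The future cone is the strict epigraph of the Euclidean norm,
  \<open>norm (fst x) < snd x\<close>, so the triangle inequality gives convexity.\<close>

lemma convex_future_cone: "convex {x. lorentz x x < 0 \<and> snd x > 0}"
proof -
  have iff: "lorentz x x < 0 \<and> snd x > 0 \<longleftrightarrow> norm (fst x) < snd x" for x :: minkowski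
  proof -
    have "lorentz x x = (norm (fst x))\<^sup>2 - (snd x)\<^sup>2"
      unfolding power2_norm_eq_inner by (simp add: lorentz_def power2_eq_square)
    moreover have "norm (fst x) < snd x \<Longrightarrow> (norm (fst x))\<^sup>2 < (snd x)\<^sup>2"
      by (rule power_strict_mono) auto
    moreover have "norm (fst x) < snd x \<Longrightarrow> 0 < snd x"
      by (rule le_less_trans[OF norm_ge_zero])
    moreover have "(norm (fst x))\<^sup>2 < (snd x)\<^sup>2 \<Longrightarrow> 0 < snd x \<Longrightarrow> norm (fst x) < snd x"
      by (rule power2_less_imp_less) auto
    ultimately show ?thesis by auto
  qed
  show ?thesis unfolding iff
  proof (rule convexI, simp)
    fix x y :: minkowski and u v :: real
    assume xy: "norm (fst x) < snd x" "norm (fst y) < snd y" and uv: "0 \<le> u" "0 \<le> v" "u + v = 1"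
    have "norm (u *\<^sub>R fst x + v *\<^sub>R fst y) \<le> u * norm (fst x) + v * norm (fst y)"
      using norm_triangle_ineq[of "u *\<^sub>R fst x" "v *\<^sub>R fst y"] uv by simp
    also have "\<dots> < u * snd x + v * snd y"
    proof (cases "u = 0")
      case True
      then show ?thesis using xy uv by simp
    next
      case False
      then show ?thesis using xy uv by (intro add_less_le_mono mult_strict_left_mono mult_left_mono) auto
    qed
    finally show "norm (u *\<^sub>R fst x + v *\<^sub>R fst y) < u * snd x + v * snd y" .
  qed
qed

lemma continuous_on_normalize_H3:
  "continuous_on {x. lorentz x x < 0} normalize_H3"
  unfolding normalize_H3_def by (intro continuous_intros) auto

text \<open>Timelike vectors have nonzero last coordinate, so \<open>snd x > 0\<close> may be
  relaxed to a closed condition.\<close>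

lemma closed_H3: "closed H3"
proof -
  have eq: "H3 = {x. lorentz x x = -1} \<inter> {x. snd x \<ge> 0}"
  proof -
    have "snd x \<noteq> 0" if "lorentz x x = -1" for x :: minkowski
      using timelike_snd_nonzero[of x] that by simp
    then show ?thesis by (fastforce simp: H3_def)
  qed
  show ?thesis
    unfolding eq by (intro closed_Int closed_Collect_eq closed_Collect_le continuous_intros)
qed

text \<open>One side of a hyperplane in the hyperboloid is the radial projection of a convex part
  \<open>K\<close> of the future cone, hence connected. A component cannot cross the zero set of the
  linear form, so it is exactly one side. A general \<open>V\<close> covers half-spaces and
  half-planes alike.\<close>

lemma half_eq:
  assumes V: "subspace V" and W: "subspace W" "W \<subseteq> V" "dim V = dim W + 1"
    and H: "half (V \<inter> H3) (W \<inter> H3) H"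
  obtains w where "w \<noteq> 0" "W = {x \<in> V. w \<bullet> x = 0}" "H = {x \<in> V \<inter> H3. w \<bullet> x \<ge> 0}"
proof -
  obtain w0 where w0: "w0 \<noteq> 0" "W = {x \<in> V. w0 \<bullet> x = 0}"
    using subspace_eq_kernel[OF V W] by blast
  obtain C where C: "C \<in> components (V \<inter> H3 - W \<inter> H3)" "H = closure C"
    using H by (auto simp: half_def)
  obtain z where z: "z \<in> C" using in_components_nonempty[OF C(1)] by blast
  have C_sub: "C \<subseteq> {x \<in> V \<inter> H3. w0 \<bullet> x \<noteq> 0}"
    using in_components_subset[OF C(1)] w0 by auto
  \<comment> \<open>The sign is chosen so that the given component lies on the positive
    side.\<close>
  define w where "w = (if w0 \<bullet> z > 0 then w0 else - w0)"
  have w: "w \<noteq> 0" "W = {x \<in> V. w \<bullet> x = 0}" "w \<bullet> z > 0"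
    using w0 C_sub z by (auto simp: w_def not_less order_less_le)
  define S where "S = {x \<in> V \<inter> H3. w \<bullet> x > 0}"
  define K where "K = {x. lorentz x x < 0 \<and> snd x > 0} \<inter> V \<inter> {x. w \<bullet> x > 0}"
  have "convex K"
    unfolding K_def by (intro convex_Int convex_future_cone subspace_imp_convex V convex_halfspace_gt)
  have S_image: "S = normalize_H3 ` K"
  proof (intro equalityI subsetI)
    fix x assume "x \<in> S"
    then have "x \<in> K" "normalize_H3 x = x"
      using normalize_H3_id by (auto simp: S_def K_def H3_def)
    then show "x \<in> normalize_H3 ` K" by (metis imageI)
  next
    fix x assume "x \<in> normalize_H3 ` K"
    then obtain y where y: "y \<in> K" "x = normalize_H3 y" by blast
    then show "x \<in> S"
      using normalize_H3_in[of y] subspace_scale[OF V, of y]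
      by (auto simp: S_def K_def normalize_H3_def)
  qed
  have "connected (normalize_H3 ` K)"
    by (intro connected_continuous_image convex_connected \<open>convex K\<close>
        continuous_on_subset[OF continuous_on_normalize_H3]) (auto simp: K_def)
  then have "connected S" using S_image by simp
  have "C \<subseteq> S"
  proof -
    have "connected C" using C by (rule_tac in_components_connected)
    then have "{x. w \<bullet> x > 0} \<inter> C = {} \<or> {x. w \<bullet> x < 0} \<inter> C = {}"
      using C_sub w w0 by (intro connectedD open_halfspace_gt open_halfspace_lt)
        (auto simp: w_def split: if_splits)
    then have "{x. w \<bullet> x < 0} \<inter> C = {}" using z w by auto
    show ?thesis
    proof
      fix x assume "x \<in> C"
      then have "w \<bullet> x \<noteq> 0" "\<not> w \<bullet> x < 0" "x \<in> V \<inter> H3"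
        using C_sub \<open>{x. w \<bullet> x < 0} \<inter> C = {}\<close> by (auto simp: w_def)
      then show "x \<in> S" by (simp add: S_def)
    qed
  qed
  moreover have "S \<subseteq> C"
  proof (rule components_maximal[OF C(1) \<open>connected S\<close>])
    show "S \<subseteq> V \<inter> H3 - W \<inter> H3" using w by (auto simp: S_def)
    show "C \<inter> S \<noteq> {}" using z \<open>C \<subseteq> S\<close> by blast
  qed
  ultimately have CS: "C = S" by blast
  have "closure S = {x \<in> V \<inter> H3. w \<bullet> x \<ge> 0}" (is "_ = ?T")
  proof
    have "closed ?T"
    proof -
      have "?T = V \<inter> H3 \<inter> {x. w \<bullet> x \<ge> 0}" by auto
      moreover have "closed (V \<inter> H3 \<inter> {x. w \<bullet> x \<ge> 0})"
        by (intro closed_Int closed_subspace[OF V] closed_H3 closed_halfspace_ge)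
      ultimately show ?thesis by simp
    qed
    then show "closure S \<subseteq> ?T"
      by (intro closure_minimal) (auto simp: S_def)
    show "?T \<subseteq> closure S"
    proof
      fix x assume x: "x \<in> ?T"
      have zV: "z \<in> V" "z \<in> H3" "w \<bullet> z > 0" using z CS by (auto simp: S_def)
      \<comment> \<open>A small multiple of the point \<open>z\<close> of the open side pushes a
        boundary point \<open>x\<close> into that side; normalizing returns it to the
        hyperboloid.\<close>
      define f where "f n = x + (1 / real (Suc n)) *\<^sub>R z" for n
      have lxz: "lorentz x z \<le> -1" "lorentz x x = -1" "lorentz z z = -1" "snd x > 0" "snd z > 0"
        using H3_lorentz_le x zV by (auto simp: H3_def)
      have "f n \<in> K" for n
      proof -
        have "f n \<in> V" using x zV V by (simp add: f_def subspace_add subspace_scale)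
        moreover have "w \<bullet> f n > 0"
          using x zV by (simp add: f_def inner_simps add_nonneg_pos)
        moreover have "lorentz (f n) (f n) = -1 + 2 * (1 / real (Suc n)) * lorentz x z - (1 / real (Suc n))\<^sup>2"
          unfolding f_def power2_eq_square
          by (simp only: lorentz_simps lxz lorentz_commute[of z x]) algebra
        moreover have "(1 / real (Suc n)) * lorentz x z \<le> 0"
          using lxz by (intro mult_nonneg_nonpos) auto
        moreover have "(1 / real (Suc n))\<^sup>2 \<ge> 0" by simp
        moreover have "snd (f n) > 0" using lxz by (simp add: f_def add_pos_pos)
        ultimately show ?thesis unfolding K_def mem_Collect_eq Int_iff by linarith
      qed
      then have in_S: "normalize_H3 (f n) \<in> S" for n
        using S_image by blast
      have "(\<lambda>n. 1 / real (Suc n)) \<longlonglongrightarrow> 0" by (rule LIMSEQ_Suc[OF lim_1_over_n])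
      then have "f \<longlonglongrightarrow> x + 0 *\<^sub>R z"
        unfolding f_def by (intro tendsto_intros)
      then have "f \<longlonglongrightarrow> x" by simp
      then have "(\<lambda>n. normalize_H3 (f n)) \<longlonglongrightarrow> normalize_H3 x"
        using \<open>\<And>n. f n \<in> K\<close> lxz
        by (intro continuous_on_tendsto_compose[OF continuous_on_normalize_H3]) (auto simp: K_def)
      then have "(\<lambda>n. normalize_H3 (f n)) \<longlonglongrightarrow> x" using x by (simp add: normalize_H3_id)
      then show "x \<in> closure S"
        unfolding closure_sequential
        by (intro exI[of _ "\<lambda>n. normalize_H3 (f n)"] conjI allI in_S)
    qed
  qed
  then show thesis using that[OF w(1,2)] C CS by simp
qed

text \<open>The witness curve r(t) p + t v stays on the hyperboloid without any normalization of
  \<open>v\<close>, so v = 0 is included. Its velocity at 0 is \<open>v\<close> because the square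
  root r has derivative 0 there.\<close>

lemma tangent_vectors_subspace:
  assumes "subspace V" "p \<in> V \<inter> H3" "v \<in> V" "lorentz v p = 0"
  shows "v \<in> tangent_vectors (V \<inter> H3) p"
proof -
  have p: "p \<in> H3" "lorentz p p = -1" using assms by (auto simp: H3_def)
  have vv: "lorentz v v \<ge> 0" using lorentz_orthogonal_nonneg p assms by blast
  define r where "r t = sqrt (1 + t\<^sup>2 * lorentz v v)" for t
  define c where "c t = r t *\<^sub>R p + t *\<^sub>R v" for t
  have r: "(r t)\<^sup>2 = 1 + t\<^sup>2 * lorentz v v" "r t > 0" for t
  proof -
    have "t\<^sup>2 * lorentz v v \<ge> 0" using vv by simp
    then have "1 + t\<^sup>2 * lorentz v v > 0" by linarith
    then show "(r t)\<^sup>2 = 1 + t\<^sup>2 * lorentz v v" "r t > 0" by (simp_all add: r_def)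
  qed
  have "c t \<in> V \<inter> H3" for t
  proof
    show "c t \<in> V" using assms by (auto simp: c_def intro: subspace_add subspace_scale)
    have "lorentz p v = 0" using assms by (simp add: lorentz_commute)
    then have "lorentz (c t) (c t) = t\<^sup>2 * lorentz v v - (r t)\<^sup>2" "lorentz (c t) p = - r t"
      using assms p by (simp_all add: c_def lorentz_simps power2_eq_square)
    then show "c t \<in> H3" using in_H3_iff[OF p(1)] r by simp
  qed
  moreover have "c 0 = p" by (simp add: c_def r_def)
  moreover have "(r has_real_derivative 0) (at 0)"
    unfolding r_def by (auto intro!: derivative_eq_intros)
  then have "(c has_vector_derivative v) (at 0)"
    unfolding c_def
    by (auto intro!: derivative_eq_intros simp: has_real_derivative_iff_has_vector_derivative)
  ultimately show ?thesis unfolding tangent_vectors_def by blast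
qed

lemma tangent_vectors_orthogonal:
  assumes "v \<in> tangent_vectors S p" "\<And>x. x \<in> S \<Longrightarrow> lorentz x n = 0"
  shows "lorentz v n = 0"
proof -
  obtain c where c: "\<forall>t. c t \<in> S" "(c has_vector_derivative v) (at 0)"
    using assms by (auto simp: tangent_vectors_def)
  have "((\<lambda>t. lorentz (c t) n) has_vector_derivative lorentz v n) (at 0)"
    by (rule bounded_linear.has_vector_derivative[OF bounded_linear_lorentz_right c(2)])
  moreover have "(\<lambda>t. lorentz (c t) n) = (\<lambda>_. 0)" using assms c by auto
  ultimately show ?thesis
    by (simp add: vector_derivative_unique_at[OF _ has_vector_derivative_const])
qed

section \<open>Planes and their unit normals\<close>

text \<open>Changing the sign of the last coordinate turns a Euclidean normal into a Lorentz normal.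
  It is spacelike because it is orthogonal to a point of \<open>H3\<close>; the factor
  \<open>c > 0\<close> preserves inequalities.\<close>

lemma spacelike_normal:
  assumes "w \<noteq> 0" "p \<in> H3" "w \<bullet> p = 0"
  obtains n c where "c > 0" "lorentz n n = 1" "\<And>x. w \<bullet> x = c * lorentz x n"
proof -
  define m :: minkowski where "m = (fst w, - snd w)"
  have wm: "w \<bullet> x = lorentz x m" for x
    by (simp add: m_def lorentz_def inner_prod_def inner_commute mult.commute)
  have "m \<noteq> 0" using assms(1) by (auto simp: m_def prod_eq_iff)
  moreover have "lorentz m p = 0" using wm assms lorentz_commute by metis
  ultimately have pos: "lorentz m m > 0"
    using lorentz_orthogonal_nonneg[OF assms(2)] by (metis order_less_le)
  define c where "c = sqrt (lorentz m m)"
  have c: "c > 0" "c * c = lorentz m m" using pos by (auto simp: c_def)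
  show thesis
  proof (rule that[of c "(1 / c) *\<^sub>R m"])
    show "lorentz ((1 / c) *\<^sub>R m) ((1 / c) *\<^sub>R m) = 1"
      using c by (simp add: lorentz_simps c(2)[symmetric])
  qed (use c wm in \<open>simp_all add: lorentz_simps\<close>)
qed

lemma hplane_normal:
  assumes "hplane P"
  obtains n where "lorentz n n = 1" "P = {x \<in> H3. lorentz x n = 0}" "dim {x. lorentz x n = 0} = 3"
proof -
  obtain V where V: "subspace V" "dim V = 3" "P = V \<inter> H3" "P \<noteq> {}"
    using assms by (auto simp: hyp_subspace_def)
  obtain w where w: "w \<noteq> 0" "V = {x \<in> UNIV. w \<bullet> x = 0}"
    by (rule subspace_eq_kernel[of UNIV V]) (use V in auto)
  obtain p where "p \<in> H3" "w \<bullet> p = 0" using V w by auto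
  then obtain n c where n: "c > 0" "lorentz n n = 1" "\<And>x. w \<bullet> x = c * lorentz x n"
    using spacelike_normal[OF w(1)] by blast
  then have "V = {x. lorentz x n = 0}" using w(2) by simp
  then show thesis using V n(2) by (intro that[of n]) auto
qed

lemma hplane_half_normal:
  assumes "hplane P" "half H3 P H"
  obtains n where "lorentz n n = 1" "P = {x \<in> H3. lorentz x n = 0}" "H = {x \<in> H3. lorentz x n \<le> 0}"
proof -
  obtain V where V: "subspace V" "dim V = 3" "P = V \<inter> H3" "P \<noteq> {}"
    using assms by (auto simp: hyp_subspace_def)
  have dim: "dim (UNIV :: minkowski set) = dim V + 1" using V by simp
  have h: "half (UNIV \<inter> H3) (V \<inter> H3) H" using assms V by simp
  obtain w where w: "w \<noteq> 0" "V = {x \<in> UNIV. w \<bullet> x = 0}" "H = {x \<in> UNIV \<inter> H3. w \<bullet> x \<ge> 0}"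
    by (rule half_eq[OF subspace_UNIV V(1) subset_UNIV dim h])
  obtain p where "p \<in> H3" "w \<bullet> p = 0" using V w by auto
  then obtain n c where "c > 0" "lorentz n n = 1" "\<And>x. w \<bullet> x = c * lorentz x n"
    using spacelike_normal[OF w(1)] by blast
  \<comment> \<open>The form from \<open>half_eq\<close> is nonnegative on \<open>H\<close>; the
    minus sign makes the normal point out of \<open>H\<close>.\<close>
  then show thesis
    using V w by (intro that[of "- n"]) (auto simp: lorentz_simps zero_le_mult_iff)
qed

text \<open>The points x + k u stay orthogonal to \<open>n\<close>, and they stay timelike because
  \<open>lorentz x u \<le> 0\<close>. Their projective images tend to \<open>u\<close>.\<close>

lemma null_in_ideal_boundary:
  assumes u: "lorentz u u = 0" "snd u = 1" "lorentz u n = 0" and x: "x \<in> H3" "lorentz x n = 0"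
  shows "u \<in> ideal_boundary {x \<in> H3. lorentz x n = 0}"
proof -
  have sx: "snd x > 0" "lorentz x x = -1" using x by (auto simp: H3_def)
  have xu: "lorentz x u \<le> 0"
  proof -
    have "(norm (fst u))\<^sup>2 = 1\<^sup>2"
      using u unfolding power2_norm_eq_inner by (simp add: lorentz_def)
    then have "norm (fst u) = 1" by (rule power2_eq_imp_eq) auto
    moreover have "fst x \<bullet> fst u \<le> norm (fst x) * norm (fst u)" by (rule norm_cauchy_schwarz)
    ultimately show ?thesis using norm_fst_H3(2)[OF x(1)] u by (simp add: lorentz_def)
  qed
  define y where "y k = x + real k *\<^sub>R u" for k
  have y: "lorentz (y k) (y k) < 0" "snd (y k) > 0" "lorentz (y k) n = 0" for k
  proof -
    have "lorentz (y k) (y k) = -1 + 2 * (real k * lorentz x u)"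
      by (simp add: y_def lorentz_simps sx u lorentz_commute[of u x])
    moreover have "real k * lorentz x u \<le> 0" using xu by (simp add: mult_nonneg_nonpos)
    ultimately show "lorentz (y k) (y k) < 0" by linarith
  qed (use sx x u in \<open>auto simp: y_def lorentz_simps add_pos_nonneg\<close>)
  let ?f = "\<lambda>x :: minkowski. (1 / snd x) *\<^sub>R x"
  have "?f (normalize_H3 (y k)) = ?f (y k)" for k
    using y[of k] by (simp add: normalize_H3_def)
  moreover have "normalize_H3 (y k) \<in> {x \<in> H3. lorentz x n = 0}" for k
    using normalize_H3_in[OF y(1,2)] y(3) by (simp add: normalize_H3_def lorentz_simps)
  ultimately have in_image: "?f (y k) \<in> ?f ` {x \<in> H3. lorentz x n = 0}" for k
    by (metis (no_types, lifting) imageI)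
  have "?f (y k) = u + (1 / (snd x + real k)) *\<^sub>R (x - snd x *\<^sub>R u)" for k
  proof -
    have s: "snd (y k) = snd x + real k" using u by (simp add: y_def)
    have y': "y k = (snd x + real k) *\<^sub>R u + (x - snd x *\<^sub>R u)"
      by (simp add: y_def algebra_simps)
    have ne: "snd x + real k \<noteq> 0" using y(2)[of k] s by simp
    have "?f (y k) = (1 / (snd x + real k)) *\<^sub>R ((snd x + real k) *\<^sub>R u + (x - snd x *\<^sub>R u))"
      unfolding s by (subst y') (rule refl)
    then show ?thesis using ne by (simp add: scaleR_right_distrib)
  qed
  moreover have "(\<lambda>k. u + (1 / (snd x + real k)) *\<^sub>R (x - snd x *\<^sub>R u)) \<longlonglongrightarrow> u + 0 *\<^sub>R (x - snd x *\<^sub>R u)"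
    by (intro tendsto_intros tendsto_divide_0[OF tendsto_const] filterlim_at_top_imp_at_infinity
        filterlim_tendsto_add_at_top[OF tendsto_const] filterlim_real_sequentially)
  ultimately have "(\<lambda>k. ?f (y k)) \<longlonglongrightarrow> u" by simp
  then have "u \<in> closure (?f ` {x \<in> H3. lorentz x n = 0})"
    unfolding closure_sequential by (intro exI[of _ "\<lambda>k. ?f (y k)"] conjI allI in_image)
  then show ?thesis using u by (simp add: ideal_boundary_def)
qed

text \<open>Unit normals of two disjoint non-parallel planes, pointing away from each other. The last
  condition says that the timelike vector \<open>m + n\<close> is future-directed.\<close>

definition ultraparallel :: "minkowski \<Rightarrow> minkowski \<Rightarrow> bool" where
  "ultraparallel m n \<longleftrightarrow>
     lorentz m m = 1 \<and> lorentz n n = 1 \<and> lorentz m n < - 1 \<and> snd (m + n) > 0"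

text \<open>With Gram determinant 1 - G^2 > 0 the span of the normals is positive definite, so
  removing from a timelike vector its component in that span leaves a timelike vector.\<close>

lemma planes_meet:
  assumes "lorentz m m = 1" "lorentz n n = 1" "(lorentz m n)\<^sup>2 < 1"
  obtains x where "x \<in> H3" "lorentz x m = 0" "lorentz x n = 0"
proof -
  define e :: minkowski where "e = (0, 1)"
  have e: "e \<in> H3" "lorentz e e = -1" by (simp_all add: e_def H3_def lorentz_def)
  define G where "G = lorentz m n"
  have G: "1 - G\<^sup>2 > 0" "lorentz m n = G" "lorentz n m = G"
    using assms by (auto simp: G_def lorentz_commute)
  define a b where "a = lorentz e m" and "b = lorentz e n"
  \<comment> \<open>Cramer's rule for the 2 by 2 Gram system that makes \<open>x\<close> orthogonal
    to both normals.\<close>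
  define \<alpha> \<beta> where "\<alpha> = (a - G * b) / (1 - G\<^sup>2)" and "\<beta> = (b - G * a) / (1 - G\<^sup>2)"
  have ab: "\<alpha> * (1 - G\<^sup>2) = a - G * b" "\<beta> * (1 - G\<^sup>2) = b - G * a"
    using G by (auto simp: \<alpha>_def \<beta>_def)
  define x where "x = e - \<alpha> *\<^sub>R m - \<beta> *\<^sub>R n"
  have "(1 - G\<^sup>2) * lorentz x m = (1 - G\<^sup>2) * 0" "(1 - G\<^sup>2) * lorentz x n = (1 - G\<^sup>2) * 0"
    unfolding x_def lorentz_simps assms G(2,3) a_def[symmetric] b_def[symmetric]
    using ab by algebra+
  then have perp: "lorentz x m = 0" "lorentz x n = 0" using G by simp_all
  have xe: "lorentz x x = lorentz x e"
    by (subst (2) x_def) (simp add: lorentz_simps perp)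
  have "(1 - G\<^sup>2) * (1 + lorentz x e) = - ((a - G * b)\<^sup>2 + (1 - G\<^sup>2) * b\<^sup>2)"
    unfolding x_def lorentz_simps e(2) lorentz_commute[of m e] lorentz_commute[of n e] a_def[symmetric] b_def[symmetric]
    using ab by algebra
  also have "\<dots> \<le> 0"
  proof -
    have "(1 - G\<^sup>2) * b\<^sup>2 \<ge> 0" "(a - G * b)\<^sup>2 \<ge> 0" using G by simp_all
    then show ?thesis by linarith
  qed
  finally have "1 + lorentz x e \<le> 0" using G by (simp add: mult_le_0_iff)
  then have tl: "lorentz x x < 0" "snd x > 0"
    using xe timelike_future_iff[OF e(1), of x] by auto
  show thesis
    using normalize_H3_in[OF tl] perp
    by (intro that[of "normalize_H3 x"]) (simp_all add: normalize_H3_def lorentz_simps)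
qed

text \<open>The Gram entry G decides. If G^2 < 1, the planes meet; if G^2 = 1, then m - G n is a
  null vector orthogonal to both normals, that is, a common ideal point. For G^2 > 1 the half-spaces
  fix the sign: m - G n and n - G m are both future-directed timelike, and the product of two such
  vectors is negative.\<close>

lemma ultraparallel_of_planes:
  fixes m n
  defines "P \<equiv> {x \<in> H3. lorentz x m = 0}" and "Q \<equiv> {x \<in> H3. lorentz x n = 0}"
  assumes unit: "lorentz m m = 1" "lorentz n n = 1" and ne: "P \<noteq> {}" "Q \<noteq> {}"
    and disj: "P \<inter> Q = {}" "\<not> parallel P Q"
    and sub: "Q \<subseteq> {x \<in> H3. lorentz x m \<le> 0}" "P \<subseteq> {x \<in> H3. lorentz x n \<le> 0}"
  shows "ultraparallel m n"
proof -
  define G where "G = lorentz m n"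
  have G: "lorentz m n = G" "lorentz n m = G" by (auto simp: G_def lorentz_commute)
  have "\<not> G\<^sup>2 < 1"
  proof
    assume "G\<^sup>2 < 1"
    then obtain x where "x \<in> H3" "lorentz x m = 0" "lorentz x n = 0"
      using planes_meet[OF unit] by (metis G_def)
    then show False using disj(1) by (auto simp: P_def Q_def)
  qed
  moreover have "G\<^sup>2 \<noteq> 1"
  proof
    assume G1: "G\<^sup>2 = 1"
    define v where "v = m - G *\<^sub>R n"
    have v: "lorentz v m = 0" "lorentz v n = 0" "lorentz v v = 0"
      using G1 by (simp_all add: v_def lorentz_simps G unit power2_eq_square)
    have "v \<noteq> 0"
    proof
      assume "v = 0"
      then have "m = G *\<^sub>R n" by (simp add: v_def)
      moreover have "G \<noteq> 0" using G1 by auto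
      ultimately have "P = Q" by (auto simp: P_def Q_def lorentz_simps)
      then show False using disj ne by auto
    qed
    then have sv: "snd v \<noteq> 0" using v by (auto simp: lorentz_def prod_eq_iff)
    define u where "u = (1 / snd v) *\<^sub>R v"
    have u: "lorentz u u = 0" "snd u = 1" "lorentz u m = 0" "lorentz u n = 0"
      using v sv by (simp_all add: u_def lorentz_simps)
    obtain p q where "p \<in> H3" "lorentz p m = 0" "q \<in> H3" "lorentz q n = 0"
      using ne unfolding P_def Q_def by blast
    then have "u \<in> ideal_boundary P" "u \<in> ideal_boundary Q"
      unfolding P_def Q_def using null_in_ideal_boundary[OF u(1,2)] u(3,4) by blast+
    then show False using disj by (auto simp: parallel_def)
  qed
  ultimately have G2: "G\<^sup>2 > 1" by simp
  \<comment> \<open>Up to sign and scale, b - G a is the foot of the common perpendicular on the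
    plane of \<open>a\<close>. Were it past-directed, its negative would normalize to a point of
    that plane outside the half-space of \<open>b\<close>.\<close>
  have future: "snd (b - G *\<^sub>R a) > 0" "lorentz (b - G *\<^sub>R a) (b - G *\<^sub>R a) < 0"
    if ab: "lorentz a a = 1" "lorentz b b = 1" "lorentz a b = G" "lorentz b a = G"
      and sub: "{x \<in> H3. lorentz x a = 0} \<subseteq> {x \<in> H3. lorentz x b \<le> 0}" for a b
  proof -
    define y where "y = b - G *\<^sub>R a"
    have y: "lorentz y a = 0" "lorentz y b = 1 - G\<^sup>2" "lorentz y y = 1 - G\<^sup>2"
      by (simp_all add: y_def lorentz_simps ab power2_eq_square)
    show tl: "lorentz (b - G *\<^sub>R a) (b - G *\<^sub>R a) < 0" using y G2 by (simp add: y_def)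
    show "snd (b - G *\<^sub>R a) > 0"
    proof (rule ccontr)
      assume "\<not> snd (b - G *\<^sub>R a) > 0"
      then have "snd (- y) > 0" using timelike_snd_nonzero[OF tl] by (simp add: y_def)
      moreover have "lorentz (- y) (- y) < 0" using y G2 by (simp add: lorentz_simps)
      ultimately have "normalize_H3 (- y) \<in> H3" by (intro normalize_H3_in)
      moreover have "lorentz (normalize_H3 (- y)) a = 0"
        by (simp add: normalize_H3_def lorentz_simps y)
      ultimately have "normalize_H3 (- y) \<in> {x \<in> H3. lorentz x a = 0}" by simp
      then have "lorentz (normalize_H3 (- y)) b \<le> 0" using sub by auto
      then show False
        using y G2 by (simp add: normalize_H3_def lorentz_simps zero_le_divide_iff)
    qed
  qed
  define y z where "y = n - G *\<^sub>R m" and "z = m - G *\<^sub>R n"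
  have y: "snd y > 0" "lorentz y y < 0" and z: "snd z > 0" "lorentz z z < 0"
    using future[OF unit G] future[OF unit(2,1) G(2,1)] sub
    by (auto simp: y_def z_def P_def Q_def)
  have "lorentz z (normalize_H3 y) < 0"
    using timelike_future_iff[OF normalize_H3_in[OF y(2,1)] z(2)] z(1) by simp
  then have "lorentz z y < 0"
    using y by (simp add: normalize_H3_def lorentz_simps divide_less_0_iff)
  moreover have "lorentz z y = G * (G\<^sup>2 - 1)"
    by (simp add: y_def z_def lorentz_simps G unit power2_eq_square algebra_simps)
  ultimately have "G < 0" using G2 by (simp add: mult_less_0_iff)
  moreover have "\<not> - 1 \<le> G"
  proof
    assume "- 1 \<le> G"
    then have "\<bar>G\<bar> \<le> 1" using \<open>G < 0\<close> by simp
    then show False using G2 abs_square_le_1[of G] by simp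
  qed
  \<comment> \<open>The two future-directed vectors add up to (1 - G)(m + n), which settles the time
    orientation of m + n.\<close>
  moreover have "snd y + snd z = (1 - G) * snd (m + n)"
    by (simp add: y_def z_def algebra_simps)
  then have "(1 - G) * snd (m + n) > 0" using y z by linarith
  ultimately show ?thesis
    using unit by (simp add: ultraparallel_def G zero_less_mult_iff)
qed

definition facing_normals ::
  "(nat \<Rightarrow> minkowski set) \<Rightarrow> (nat \<Rightarrow> minkowski set) \<Rightarrow> (nat \<Rightarrow> minkowski) \<Rightarrow> bool" where
  "facing_normals P H n \<longleftrightarrow>
     (\<forall>i\<in>{1..4}. P i = {x \<in> H3. lorentz x (n i) = 0} \<and> H i = {x \<in> H3. lorentz x (n i) \<le> 0} \<and>
        (\<forall>j\<in>{1..4} - {i}. ultraparallel (n i) (n j)))"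

lemma admissible_facing_normals:
  assumes "admissible P H"
  obtains n where "facing_normals P H n"
proof -
  have ex: "\<exists>n. lorentz n n = 1 \<and> P i = {x \<in> H3. lorentz x n = 0} \<and> H i = {x \<in> H3. lorentz x n \<le> 0}"
    if "i \<in> {1..4}" for i
  proof -
    have "hplane (P i)" "half H3 (P i) (H i)" using assms that unfolding admissible_def by blast+
    then show ?thesis by (rule hplane_half_normal) blast
  qed
  define n where
    "n i = (SOME n. lorentz n n = 1 \<and> P i = {x \<in> H3. lorentz x n = 0} \<and> H i = {x \<in> H3. lorentz x n \<le> 0})"
    for i
  have n: "lorentz (n i) (n i) = 1 \<and> P i = {x \<in> H3. lorentz x (n i) = 0} \<and> H i = {x \<in> H3. lorentz x (n i) \<le> 0}"
    if "i \<in> {1..4}" for i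
    unfolding n_def by (rule someI_ex[OF ex[OF that]])
  have "ultraparallel (n i) (n j)" if ij: "i \<in> {1..4}" "j \<in> {1..4} - {i}" for i j
  proof -
    have j: "j \<in> {1..4}" "i \<in> {1..4} - {j}" using ij by auto
    have i: "hplane (P i)" "P i \<inter> P j = {}" "\<not> parallel (P i) (P j)" "P j \<subseteq> H i"
      using assms ij unfolding admissible_def by blast+
    have j': "hplane (P j)" "P i \<subseteq> H j"
      using assms j unfolding admissible_def by blast+
    have ne: "P i \<noteq> {}" "P j \<noteq> {}" using i(1) j'(1) by (auto simp: hyp_subspace_def)
    show ?thesis
      using n[OF ij(1)] n[OF j(1)] ne i(2-4) j'(2)
      by (intro ultraparallel_of_planes) simp_all
  qed
  then have "facing_normals P H n" using n unfolding facing_normals_def by simp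
  then show thesis by (rule that)
qed

text \<open>At a point of its own plane a linear normal is also a normal vector in the tangent-space
  sense: it is tangent to \<open>H3\<close> there and orthogonal to all velocities in the plane. One
  common point then suffices.\<close>

lemma planes_perp_normals:
  assumes perp: "planes_perp {x \<in> H3. lorentz x m = 0} {x \<in> H3. lorentz x n = 0}"
  shows "lorentz m n = 0"
proof -
  obtain p where p: "p \<in> H3" "lorentz p m = 0" "lorentz p n = 0"
    using perp[unfolded planes_perp_def, THEN conjunct1] by blast
  have "k \<in> normal_vectors {x \<in> H3. lorentz x k = 0} p" if "lorentz p k = 0" for k
  proof -
    have "k \<in> tangent_vectors (UNIV \<inter> H3) p"
      using p(1) that lorentz_commute[of k p] by (intro tangent_vectors_subspace) simp_all
    moreover have "lorentz k v = 0" if "v \<in> tangent_vectors {x \<in> H3. lorentz x k = 0} p" for v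
      using tangent_vectors_orthogonal[OF that, of k] by (simp add: lorentz_commute)
    ultimately show ?thesis by (simp add: normal_vectors_def)
  qed
  then have "m \<in> normal_vectors {x \<in> H3. lorentz x m = 0} p"
    "n \<in> normal_vectors {x \<in> H3. lorentz x n = 0} p" using p by simp_all
  moreover have "p \<in> {x \<in> H3. lorentz x m = 0} \<inter> {x \<in> H3. lorentz x n = 0}" using p by simp
  ultimately show ?thesis
    using perp[unfolded planes_perp_def, THEN conjunct2, THEN bspec, THEN bspec, THEN bspec, of p m n]
    by simp
qed

lemma subspace_lorentz_orthogonal: "subspace {x. lorentz x n = 0}"
  by (auto simp: subspace_def lorentz_simps)

text \<open>Let u be a direction of the line at \<open>p\<close> and v its component orthogonal to
  \<open>n\<close>. Then v is tangent to the plane, so u is orthogonal to v and v has square 0.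
  Hence v = 0, and u is a multiple of \<open>n\<close>.\<close>

lemma normal_in_perpendicular_line:
  assumes V: "subspace V" "dim V = 2" and perp: "line_perp_plane (V \<inter> H3) {x \<in> H3. lorentz x n = 0}"
    and n: "lorentz n n = 1"
  shows "n \<in> V"
proof -
  obtain p where p: "p \<in> V" "p \<in> H3" "lorentz p n = 0" "lorentz p p = -1"
    using perp[unfolded line_perp_plane_def, THEN conjunct1] by (auto simp: H3_def)
  have "\<not> V \<subseteq> span {p}"
  proof
    assume "V \<subseteq> span {p}"
    then have "dim V \<le> card {p}" by (intro dim_le_card) auto
    then show False using V by simp
  qed
  then obtain a where a: "a \<in> V" "a \<notin> span {p}" by blast
  \<comment> \<open>Gram-Schmidt, with a plus sign because \<open>p\<close> has square -1.\<close>
  define u where "u = a + lorentz a p *\<^sub>R p"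
  have u: "u \<in> V" "lorentz u p = 0"
    using a p V by (auto simp: u_def lorentz_simps intro: subspace_add subspace_scale)
  have "u \<noteq> 0"
  proof
    assume "u = 0"
    then have "a = (- lorentz a p) *\<^sub>R p" by (simp add: u_def eq_neg_iff_add_eq_0)
    also have "\<dots> \<in> span {p}" by (intro span_mul span_base) simp
    finally show False using a by simp
  qed
  define v where "v = u - lorentz u n *\<^sub>R n"
  have v: "lorentz v n = 0" "lorentz v p = 0"
    using u p n by (simp_all add: v_def lorentz_simps lorentz_commute[of n p])
  have "u \<in> tangent_vectors (V \<inter> H3) p"
    using tangent_vectors_subspace V u p by simp
  moreover have "v \<in> tangent_vectors ({x. lorentz x n = 0} \<inter> H3) p"
    using tangent_vectors_subspace[OF subspace_lorentz_orthogonal] v p by simp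
  moreover have "{x. lorentz x n = 0} \<inter> H3 = {x \<in> H3. lorentz x n = 0}" by auto
  moreover have "p \<in> (V \<inter> H3) \<inter> {x \<in> H3. lorentz x n = 0}" using p by simp
  ultimately have "lorentz u v = 0"
    using perp[unfolded line_perp_plane_def, THEN conjunct2, THEN bspec, THEN bspec, THEN bspec, of p u v]
    by simp
  then have "lorentz v v = 0"
    using v by (subst v_def) (simp add: lorentz_simps lorentz_commute[of n v])
  then have "v = 0" using lorentz_orthogonal_nonneg(2) p v by blast
  then obtain k where k: "u = k *\<^sub>R n" by (simp add: v_def)
  with \<open>u \<noteq> 0\<close> have "k \<noteq> 0" by auto
  then have "n = (1 / k) *\<^sub>R u" by (simp add: k)
  then show ?thesis using u(1) subspace_scale[OF V(1)] by simp
qed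

text \<open>The linear plane carrying the line contains both normals, which are independent because
  their product is below -1; the dimensions then agree. In particular the common perpendicular is
  unique.\<close>

lemma common_perpendicular_eq:
  assumes mn: "ultraparallel m n"
    and L: "common_perpendicular {x \<in> H3. lorentz x m = 0} {x \<in> H3. lorentz x n = 0} L"
  shows "L = span {m, n} \<inter> H3" "dim (span {m, n}) = 2"
proof -
  have unit: "lorentz m m = 1" "lorentz n n = 1" "lorentz m n < -1" using mn by (auto simp: ultraparallel_def)
  obtain V where V: "subspace V" "dim V = 1 + 1" "L = V \<inter> H3"
    using L unfolding common_perpendicular_def hyp_subspace_def by blast
  then have "dim V = 2" by simp
  have "m \<in> V" "n \<in> V"
    using normal_in_perpendicular_line[OF V(1) \<open>dim V = 2\<close>] L V(3) unit by (auto simp: common_perpendicular_def)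
  have "n \<noteq> 0" using unit by (auto simp: lorentz_simps)
  have "m \<notin> span {n}"
  proof
    assume "m \<in> span {n}"
    then obtain k where k: "m = k *\<^sub>R n" by (auto simp: span_singleton)
    then have "k * k = 1" "k < -1" using unit by (auto simp: lorentz_simps)
    moreover have "1 * 1 < (- k) * (- k)" using \<open>k < -1\<close> by (intro mult_strict_mono) auto
    ultimately show False by simp
  qed
  then have "independent {m, n}" "m \<noteq> n"
    using \<open>n \<noteq> 0\<close> by (auto simp: independent_insert intro: span_base)
  then show dim: "dim (span {m, n}) = 2" by (simp add: dim_eq_card_independent)
  have "span {m, n} = V"
    using V dim \<open>m \<in> V\<close> \<open>n \<in> V\<close> by (intro subspace_dim_equal span_minimal) auto
  then show "L = span {m, n} \<inter> H3" using V by simp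
qed

section \<open>Common perpendiculars\<close>

definition half_length :: "minkowski \<Rightarrow> minkowski \<Rightarrow> real" where
  "half_length m n = arcosh (- lorentz m n) / 2"

text \<open>The common perpendicular of two ultraparallel planes, parametrized by arclength from its
  midpoint.\<close>

definition edge_point :: "minkowski \<Rightarrow> minkowski \<Rightarrow> real \<Rightarrow> minkowski" where
  "edge_point m n s = (1 / sinh (2 * half_length m n)) *\<^sub>R
     (cosh (s - half_length m n) *\<^sub>R m + cosh (s + half_length m n) *\<^sub>R n)"

lemma hset_dist_eq:
  assumes "A \<subseteq> H3" "B \<subseteq> H3" "shortest_arc A B x y"
  shows "hset_dist A B = hdist x y"
  unfolding hset_dist_def
proof (rule cInf_eq_minimum)
  show "hdist x y \<in> {hdist x y |x y. x \<in> A \<and> y \<in> B}"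
    using assms(3) unfolding shortest_arc_def by blast
  show "hdist x y \<le> r" if "r \<in> {hdist x y |x y. x \<in> A \<and> y \<in> B}" for r
    using that assms(3) unfolding shortest_arc_def by blast
qed

lemma half_length_sym: "half_length n m = half_length m n"
  by (simp add: half_length_def lorentz_commute)

lemma edge_point_sym: "edge_point n m s = edge_point m n (- s)"
proof -
  have *: "cosh (- s - h) = cosh (s + h)" "cosh (- s + h) = cosh (s - h)" for h
    by (simp_all add: abs_if)
  show ?thesis
    unfolding edge_point_def half_length_sym[of n m] * by (rule arg_cong[OF add.commute])
qed

locale ultraparallel_pair =
  fixes m n :: minkowski
  assumes ultraparallel: "ultraparallel m n"
begin

abbreviation "h \<equiv> half_length m n"
abbreviation "c \<equiv> edge_point m n"
abbreviation "P \<equiv> {x \<in> H3. lorentz x m = 0}"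
abbreviation "Q \<equiv> {x \<in> H3. lorentz x n = 0}"

lemma unit: "lorentz m m = 1" "lorentz n n = 1"
  using ultraparallel by (auto simp: ultraparallel_def)

lemma lorentz_normals: "lorentz m n = - cosh (2 * h)" "lorentz n m = - cosh (2 * h)"
  using ultraparallel lorentz_commute[of n m] by (auto simp: ultraparallel_def half_length_def cosh_arcosh_real)

lemma h_pos: "h > 0"
  using ultraparallel by (simp add: ultraparallel_def half_length_def)

lemma sinh_pos: "sinh (2 * h) > 0"
  using h_pos by simp

lemma cosh_gt_1: "cosh (2 * h) > 1"
  using ultraparallel lorentz_normals(1) by (simp add: ultraparallel_def)

lemma lorentz_edge_point:
  "lorentz x (c s) = (cosh (s - h) * lorentz x m + cosh (s + h) * lorentz x n) / sinh (2 * h)"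
  by (simp add: edge_point_def lorentz_simps)

text \<open>The product with a unit normal is, up to sign, the sinh of the signed distance to its
  plane. It locates the feet at s = - h and s = h, and both products are nonpositive exactly on
  [- h, h].\<close>

lemma lorentz_edge_point_normal:
  "lorentz (c s) m = - sinh (s + h)" "lorentz (c s) n = sinh (s - h)"
proof -
  have 1: "cosh (s - h) = cosh (s + h) * cosh (2 * h) - sinh (s + h) * sinh (2 * h)"
    using cosh_diff[of "s + h" "2 * h"] by simp
  have 2: "cosh (s + h) = cosh (s - h) * cosh (2 * h) + sinh (s - h) * sinh (2 * h)"
    using cosh_add[of "s - h" "2 * h"] by (simp add: add.commute)
  have "lorentz m (c s) = - sinh (s + h)"
    unfolding lorentz_edge_point unit lorentz_normals using sinh_pos
    by (subst 1) (simp add: field_simps)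
  then show "lorentz (c s) m = - sinh (s + h)" by (simp add: lorentz_commute)
  have "lorentz n (c s) = sinh (s - h)"
    unfolding lorentz_edge_point unit lorentz_normals using sinh_pos
    by (subst 2) (simp add: field_simps)
  then show "lorentz (c s) n = sinh (s - h)" by (simp add: lorentz_commute)
qed

lemma lorentz_edge_points: "lorentz (c s) (c t) = - cosh (s - t)"
proof -
  have "cosh (t - h) * - sinh (s + h) + cosh (t + h) * sinh (s - h) = - cosh (s - t) * sinh (2 * h)"
    unfolding sinh_add sinh_diff cosh_add cosh_diff sinh_double by algebra
  then show ?thesis
    unfolding lorentz_edge_point lorentz_edge_point_normal using sinh_pos by simp
qed

lemma lorentz_foot_points: "lorentz (c (- h)) (c h) = - cosh (2 * h)"
proof -
  have "- h - h = - (2 * h)" by simp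
  then show ?thesis by (simp only: lorentz_edge_points cosh_minus)
qed

lemma edge_point_H3: "c s \<in> H3"
proof -
  have 0: "c 0 \<in> H3"
    using ultraparallel sinh_pos lorentz_edge_points[of 0 0]
    by (simp add: H3_def edge_point_def ultraparallel_def distrib_left[symmetric] zero_less_mult_iff)
  show ?thesis
    using in_H3_iff[OF 0, of "c s"] lorentz_edge_points[of s 0] lorentz_edge_points[of s s] by simp
qed

lemma hdist_edge_points: "hdist (c s) (c t) = \<bar>s - t\<bar>"
proof -
  have "cosh (s - t) = cosh \<bar>s - t\<bar>" by simp
  then show ?thesis
    unfolding hdist_def lorentz_edge_points minus_minus by (metis abs_ge_zero arcosh_cosh_real)
qed

lemma edge_point_in_span: "c s \<in> span {m, n}"
  unfolding edge_point_def by (intro span_mul span_add) (simp_all add: span_base)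

text \<open>The parameter \<open>s\<close> is chosen so that \<open>c s\<close> and \<open>x\<close>
  have the same product with \<open>m\<close>. Their difference then lies on the line of the span
  orthogonal to \<open>m\<close>, which is generated by the foot \<open>c (- h)\<close>.\<close>

lemma span_H3: "span {m, n} \<inter> H3 = range c"
proof (intro equalityI subsetI)
  fix x assume "x \<in> span {m, n} \<inter> H3"
  then have x: "x \<in> span {m, n}" "x \<in> H3" by auto
  define s where "s = arsinh (- lorentz x m) - h"
  have s: "sinh (s + h) = - lorentz x m" by (simp add: s_def)
  define w where "w = x - c s"
  have wm: "lorentz w m = 0" by (simp add: w_def lorentz_simps lorentz_edge_point_normal s)
  have "w \<in> span {m, n}" using x edge_point_in_span by (simp add: w_def span_diff)
  then obtain a b where ab: "w = a *\<^sub>R m + b *\<^sub>R n"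
    by (auto simp: span_insert span_singleton algebra_simps)
  define \<tau> where "\<tau> = b * sinh (2 * h)"
  have "a = b * cosh (2 * h)" using wm by (simp add: ab lorentz_simps unit lorentz_normals)
  then have "w = \<tau> *\<^sub>R c (- h)"
    using sinh_pos by (simp add: ab \<tau>_def edge_point_def scaleR_right_distrib)
  then have xc: "x = c s + \<tau> *\<^sub>R c (- h)" by (simp add: w_def algebra_simps)
  have "lorentz x x = -1" using x by (simp add: H3_def)
  moreover have "lorentz x x = -1 - 2 * \<tau> * cosh (s + h) - \<tau> * \<tau>"
  proof -
    have "- h - s = - (s + h)" by simp
    then have "cosh (- h - s) = cosh (s + h)" by (simp only: cosh_minus)
    then show ?thesis
      unfolding xc by (simp only: lorentz_simps lorentz_edge_points) (simp add: algebra_simps)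
  qed
  ultimately have "\<tau> * (2 * cosh (s + h) + \<tau>) = 0" by (simp add: algebra_simps)
  \<comment> \<open>The second root of this quadratic would put \<open>x\<close> on the past
    sheet.\<close>
  moreover have "2 * cosh (s + h) + \<tau> \<noteq> 0"
  proof
    assume "2 * cosh (s + h) + \<tau> = 0"
    then have \<tau>: "\<tau> = - 2 * cosh (s + h)" by simp
    have "lorentz x (c (- h)) = cosh (s + h)"
      by (simp add: xc lorentz_simps lorentz_edge_points \<tau>)
    moreover have "lorentz x (c (- h)) \<le> -1" by (rule H3_lorentz_le[OF x(2) edge_point_H3])
    moreover have "cosh (s + h) > 0" by simp
    ultimately show False by linarith
  qed
  ultimately show "x \<in> range c" using xc by simp
qed (use edge_point_in_span edge_point_H3 in auto)

text \<open>A normal and the foot on its own plane span the same linear plane as the two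
  normals.\<close>

lemma orthogonal_edge_points:
  assumes "lorentz w (c (- h)) = 0 \<and> lorentz w m = 0 \<or> lorentz w (c h) = 0 \<and> lorentz w n = 0"
  shows "lorentz w (c s) = 0"
proof -
  have "lorentz w m = 0 \<and> lorentz w n = 0"
    using assms sinh_pos unfolding lorentz_edge_point by (auto simp: divide_eq_0_iff)
  then show ?thesis by (simp add: lorentz_edge_point)
qed

text \<open>Split \<open>x \<in> P\<close> and \<open>y \<in> Q\<close> into a multiple of the foot of the common perpendicular and a
  vector in the positive definite orthogonal complement of the span of the two normals.\<close>

lemma dist_planes:
  assumes x: "x \<in> P" and y: "y \<in> Q"
  shows "cosh (2 * h) \<le> - lorentz x y"
    and "- lorentz x y \<le> cosh (2 * h) \<Longrightarrow> x = c (- h) \<and> y = c h"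
proof -
  let ?u = "c (- h)" and ?v = "c h"
  define a b where "a = - lorentz x ?u" and "b = - lorentz y ?v"
  define w z where "w = x - a *\<^sub>R ?u" and "z = y - b *\<^sub>R ?v"
  have ab: "a \<ge> 1" "b \<ge> 1"
    using H3_lorentz_le[OF _ edge_point_H3, of x "- h"] H3_lorentz_le[OF _ edge_point_H3, of y h] x y
    unfolding a_def b_def by simp_all
  have uu: "lorentz (c s) (c s) = -1" for s by (simp add: lorentz_edge_points)
  have perp_foot: "lorentz w ?u = 0" "lorentz w m = 0" "lorentz z ?v = 0" "lorentz z n = 0"
    using x y by (simp_all add: w_def z_def lorentz_simps uu a_def b_def lorentz_edge_point_normal)
  have perp: "lorentz w (c s) = 0" "lorentz z (c s) = 0" for s
    by (rule orthogonal_edge_points, simp add: perp_foot)+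
  have perp': "lorentz (c s) w = 0" "lorentz (c s) z = 0" for s
    using perp[of s] by (simp_all add: lorentz_commute)
  have xw: "x = a *\<^sub>R ?u + w" and yz: "y = b *\<^sub>R ?v + z" by (simp_all add: w_def z_def)
  have "lorentz x x = lorentz w w - a\<^sup>2" "lorentz y y = lorentz z z - b\<^sup>2"
    unfolding xw yz by (simp_all add: lorentz_simps uu perp perp' power2_eq_square)
  then have ww: "lorentz w w = a\<^sup>2 - 1" and zz: "lorentz z z = b\<^sup>2 - 1"
    using x y by (auto simp: H3_def)
  have "lorentz x y = a * b * lorentz ?u ?v + lorentz w z"
    unfolding xw yz by (simp add: lorentz_simps perp perp')
  then have xy: "lorentz x y = lorentz w z - a * b * cosh (2 * h)"
    by (simp add: lorentz_foot_points)
  have "(lorentz w z)\<^sup>2 \<le> (a\<^sup>2 - 1) * (b\<^sup>2 - 1)"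
    using lorentz_Cauchy_Schwarz[OF edge_point_H3 perp] by (simp add: ww zz)
  also have "\<dots> \<le> (a * b - 1)\<^sup>2"
    using zero_le_power2[of "a - b"] by (simp add: power2_eq_square algebra_simps)
  finally have sq: "(lorentz w z)\<^sup>2 \<le> (a * b - 1)\<^sup>2" .
  have ab1: "1 * 1 \<le> a * b" using ab by (intro mult_mono) auto
  have "lorentz w z \<le> a * b - 1"
    by (rule power2_le_imp_le[OF sq]) (use ab1 in simp)
  \<comment> \<open>The excess over cosh (2 h) is written as a product of nonnegative factors, the
    second one positive, so that its vanishing forces a b = 1.\<close>
  then have lb: "- lorentz x y \<ge> cosh (2 * h) + (a * b - 1) * (cosh (2 * h) - 1)"
    unfolding xy by (simp add: algebra_simps)
  have "(a * b - 1) * (cosh (2 * h) - 1) \<ge> 0"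
    using ab1 cosh_gt_1 by (intro mult_nonneg_nonneg) auto
  then show "cosh (2 * h) \<le> - lorentz x y" using lb by linarith
  assume "- lorentz x y \<le> cosh (2 * h)"
  then have "(a * b - 1) * (cosh (2 * h) - 1) \<le> 0"
    using lb by linarith
  then have "a * b \<le> 1" using cosh_gt_1 by (simp add: mult_le_0_iff)
  moreover have "a * 1 \<le> a * b" using ab by (intro mult_left_mono) auto
  moreover have "1 * b \<le> a * b" using ab by (intro mult_right_mono) auto
  ultimately have "a = 1" "b = 1" using ab by linarith+
  then have "w = 0" "z = 0"
    using ww zz by (auto intro: lorentz_orthogonal_nonneg(2)[OF edge_point_H3 perp(1)]
        lorentz_orthogonal_nonneg(2)[OF edge_point_H3 perp(2)])
  with \<open>a = 1\<close> \<open>b = 1\<close> show "x = c (- h) \<and> y = c h" using xw yz by simp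
qed

lemma foot_points: "c (- h) \<in> P" "c h \<in> Q"
  by (auto simp: edge_point_H3 lorentz_edge_point_normal)

lemma shortest_arc_planes: "shortest_arc P Q x y \<longleftrightarrow> x = c (- h) \<and> y = c h"
proof -
  have uv: "- lorentz (c (- h)) (c h) = cosh (2 * h)" by (simp add: lorentz_foot_points)
  have le: "hdist x y \<le> hdist x' y' \<longleftrightarrow> - lorentz x y \<le> - lorentz x' y'"
    if "x \<in> P" "y \<in> Q" "x' \<in> P" "y' \<in> Q" for x y x' y'
    using that by (intro hdist_le_iff) auto
  show ?thesis
  proof
    assume s: "shortest_arc P Q x y"
    then have xy: "x \<in> P" "y \<in> Q" and d: "hdist x y \<le> hdist (c (- h)) (c h)"
      using foot_points unfolding shortest_arc_def by blast+
    have "- lorentz x y \<le> cosh (2 * h)"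
      using d unfolding le[OF xy foot_points] uv .
    then show "x = c (- h) \<and> y = c h" by (rule dist_planes(2)[OF xy])
  next
    assume eq: "x = c (- h) \<and> y = c h"
    show "shortest_arc P Q x y"
      unfolding shortest_arc_def
    proof (intro conjI ballI)
      fix x' y' assume x'y': "x' \<in> P" "y' \<in> Q"
      then have "- lorentz (c (- h)) (c h) \<le> - lorentz x' y'"
        using dist_planes(1)[OF x'y'] uv by linarith
      then show "hdist x y \<le> hdist x' y'"
        using le[OF foot_points x'y'] eq by (simp only:)
    qed (use eq foot_points in simp_all)
  qed
qed

lemma hset_dist_planes: "hset_dist P Q = 2 * h"
proof -
  have "hset_dist P Q = hdist (c (- h)) (c h)"
    by (intro hset_dist_eq) (auto simp: shortest_arc_planes)
  then show ?thesis using h_pos by (simp add: hdist_edge_points)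
qed

lemma hsegment_foot_points: "hsegment (c (- h)) (c h) = c ` {- h..h}"
proof (intro equalityI subsetI)
  fix z assume z: "z \<in> hsegment (c (- h)) (c h)"
  have ne: "c (- h) \<noteq> c h"
  proof
    assume "c (- h) = c h"
    then have "hdist (c (- h)) (c h) = hdist (c h) (c h)" by simp
    then show False unfolding hdist_edge_points using h_pos by simp
  qed
  have "span {c (- h), c h} \<subseteq> span {m, n}"
    using edge_point_in_span by (intro span_minimal) auto
  moreover have "z \<in> span {c (- h), c h}"
    by (rule hsegment_in_span[OF edge_point_H3 edge_point_H3 ne z])
  moreover have "z \<in> H3" using z by (simp add: hsegment_def)
  ultimately have "z \<in> range c" unfolding span_H3[symmetric] by blast
  then obtain s where s: "z = c s" by blast
  then have "\<bar>- h - s\<bar> + \<bar>s - h\<bar> = \<bar>- h - h\<bar>"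
    using z by (simp only: hsegment_def mem_Collect_eq hdist_edge_points)
  then have "s \<in> {- h..h}" using h_pos by (simp add: abs_if split: if_splits)
  then show "z \<in> c ` {- h..h}" using s by blast
next
  fix z assume "z \<in> c ` {- h..h}"
  then show "z \<in> hsegment (c (- h)) (c h)"
    by (auto simp: hsegment_def hdist_edge_points edge_point_H3)
qed

end

section \<open>Sums of exponentials and the distance between two edges\<close>

lemma exp_balance_iff:
  fixes \<alpha> \<delta> u :: real
  assumes "\<alpha> > 0" "\<delta> > 0"
  shows "\<alpha> * exp u = \<delta> * exp (- u) \<longleftrightarrow> u = ln (\<delta> / \<alpha>) / 2"
proof -
  have "\<alpha> * exp u = \<delta> * exp (- u) \<longleftrightarrow> exp (2 * u) = \<delta> / \<alpha>"
  proof -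
    have "exp (2 * u) = exp u * exp u" by (simp add: exp_add[symmetric])
    then show ?thesis using assms by (simp add: exp_minus field_simps)
  qed
  also have "\<dots> \<longleftrightarrow> 2 * u = ln (\<delta> / \<alpha>)"
    using assms by (metis exp_ln ln_exp divide_pos_pos)
  finally show ?thesis by auto
qed

text \<open>The product of the two terms does not depend on u, so the geometric mean is a constant
  bound.\<close>

lemma exp_sum_ge:
  fixes \<alpha> \<delta> u :: real
  assumes "\<alpha> > 0" "\<delta> > 0"
  shows "2 * sqrt (\<alpha> * \<delta>) \<le> \<alpha> * exp u + \<delta> * exp (- u)"
    and "\<alpha> * exp u = \<delta> * exp (- u) \<Longrightarrow> \<alpha> * exp u + \<delta> * exp (- u) = 2 * sqrt (\<alpha> * \<delta>)"
proof -
  have eq: "\<alpha> * \<delta> = (\<alpha> * exp u) * (\<delta> * exp (- u))" by (simp add: exp_minus)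
  show "2 * sqrt (\<alpha> * \<delta>) \<le> \<alpha> * exp u + \<delta> * exp (- u)"
    using arith_geo_mean_sqrt[of "\<alpha> * exp u" "\<delta> * exp (- u)"] assms unfolding eq by simp
  show "\<alpha> * exp u + \<delta> * exp (- u) = 2 * sqrt (\<alpha> * \<delta>)" if "\<alpha> * exp u = \<delta> * exp (- u)"
  proof -
    have "0 < \<delta> * exp (- u)" using assms by simp
    then show ?thesis unfolding eq that by simp
  qed
qed

lemma exp_sum_critical_point:
  fixes \<alpha> \<beta> \<gamma> \<delta> :: real
  defines "f \<equiv> \<lambda>z. \<alpha> * exp (fst z + snd z) + \<beta> * exp (fst z - snd z)
                  + \<gamma> * exp (snd z - fst z) + \<delta> * exp (- fst z - snd z)"
  assumes pos: "\<alpha> > 0" "\<beta> > 0" "\<gamma> > 0" "\<delta> > 0"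
  obtains s t where "\<And>z. critical_point f z \<longleftrightarrow> z = (s, t)" "\<And>z. f (s, t) \<le> f z"
    "f (s, t) = 2 * sqrt (\<alpha> * \<delta>) + 2 * sqrt (\<beta> * \<gamma>)"
    "\<alpha> * exp (s + t) = \<delta> * exp (- s - t)" "\<beta> * exp (s - t) = \<gamma> * exp (t - s)"
proof -
  define p q where "p = ln (\<delta> / \<alpha>) / 2" and "q = ln (\<gamma> / \<beta>) / 2"
  define s t where "s = (p + q) / 2" and "t = (p - q) / 2"
  have f: "f z = (\<alpha> * exp (fst z + snd z) + \<delta> * exp (- (fst z + snd z)))
               + (\<beta> * exp (fst z - snd z) + \<gamma> * exp (- (fst z - snd z)))" for z
    by (simp add: f_def)
  have st: "s + t = p" "s - t = q" by (simp_all add: s_def t_def field_simps)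
  have bal: "\<alpha> * exp (s + t) = \<delta> * exp (- (s + t))" "\<beta> * exp (s - t) = \<gamma> * exp (- (s - t))"
    using exp_balance_iff[OF pos(1,4), of "s + t"] exp_balance_iff[OF pos(2,3), of "s - t"] st
    unfolding p_def q_def by blast+
  have val: "f (s, t) = 2 * sqrt (\<alpha> * \<delta>) + 2 * sqrt (\<beta> * \<gamma>)"
    unfolding f fst_conv snd_conv
    using exp_sum_ge(2)[OF pos(1,4) bal(1)] exp_sum_ge(2)[OF pos(2,3) bal(2)] by simp
  have min: "f (s, t) \<le> f z" for z
    unfolding val f[of z] by (intro add_mono exp_sum_ge(1) pos)
  have crit: "critical_point f z \<longleftrightarrow> z = (s, t)" for z
  proof -
    define A B where "A = \<alpha> * exp (fst z + snd z) - \<delta> * exp (- (fst z + snd z))"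
      and "B = \<beta> * exp (fst z - snd z) - \<gamma> * exp (- (fst z - snd z))"
    have der: "(f has_derivative (\<lambda>w. A * (fst w + snd w) + B * (fst w - snd w))) (at z)"
      unfolding f_def A_def B_def
      by (auto intro!: derivative_eq_intros simp: algebra_simps)
    have "critical_point f z \<longleftrightarrow> A = 0 \<and> B = 0"
    proof
      assume "critical_point f z"
      then have "(\<lambda>w. A * (fst w + snd w) + B * (fst w - snd w)) = (\<lambda>_. 0)"
        unfolding critical_point_def by (rule has_derivative_unique[OF der])
      \<comment> \<open>The directions (1, 1) and (1, -1) isolate \<open>A\<close> and
        \<open>B\<close>.\<close>
      from fun_cong[OF this, of "(1, 1)"] fun_cong[OF this, of "(1, -1)"]
      show "A = 0 \<and> B = 0" by simp
    next
      assume "A = 0 \<and> B = 0"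
      then show "critical_point f z" using der by (simp add: critical_point_def)
    qed
    also have "\<dots> \<longleftrightarrow> fst z + snd z = p \<and> fst z - snd z = q"
      using exp_balance_iff[OF pos(1,4), of "fst z + snd z"] exp_balance_iff[OF pos(2,3), of "fst z - snd z"]
      by (simp add: A_def B_def p_def q_def)
    also have "\<dots> \<longleftrightarrow> z = (s, t)"
      by (cases z) (auto simp: s_def t_def)
    finally show ?thesis .
  qed
  show thesis
    by (rule that[OF crit min val]) (use bal in simp_all)
qed

text \<open>For edges of half-lengths h and k measured from their midpoints, this is 4 sinh (2 h)
  sinh (2 k) times the coefficient of exp (s + t) in D(s, t). Flipping the signs of h and k gives
  the other three coefficients.\<close>

definition cross_sum :: "real \<Rightarrow> real \<Rightarrow> real \<Rightarrow> real \<Rightarrow> real \<Rightarrow> real \<Rightarrow> real" where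
  "cross_sum h k a b c d = a * exp (- h - k) + b * exp (k - h) + c * exp (h - k) + d * exp (h + k)"

lemma cross_sum_cosh:
  fixes s t h k :: real
  shows "a * (cosh (s - h) * cosh (t - k)) + b * (cosh (s - h) * cosh (t + k))
       + c * (cosh (s + h) * cosh (t - k)) + d * (cosh (s + h) * cosh (t + k))
     = (cross_sum h k a b c d * exp (s + t) + cross_sum h (- k) a b c d * exp (s - t)
       + cross_sum (- h) k a b c d * exp (t - s) + cross_sum (- h) (- k) a b c d * exp (- s - t)) / 4"
proof -
  have e: "exp (x - y) = exp x * exp (- y)" for x y :: real
    using exp_add[of x "- y"] by simp
  show ?thesis
    by (simp add: cross_sum_def cosh_def exp_add e field_simps)
qed

lemma cross_sum_pos: "\<lbrakk>a > 0; b > 0; c > 0; d > 0\<rbrakk> \<Longrightarrow> cross_sum h k a b c d > 0"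
  by (simp add: cross_sum_def add_pos_pos)

lemma cross_sum_swap: "cross_sum h k a b c d = cross_sum k h a c b d"
  by (simp add: cross_sum_def algebra_simps)

lemma cross_sum_flip:
  "cross_sum h k b a d c = cross_sum h (- k) a b c d"
  "cross_sum h k c d a b = cross_sum (- h) k a b c d"
  by (simp_all add: cross_sum_def algebra_simps)

text \<open>Flipping h shifts each exponent by 2 h or - 2 h, and all weights are positive. This
  estimate is what keeps the critical point on the edges.\<close>

lemma cross_sum_flip_le:
  assumes "\<bar>h\<bar> \<le> r" "a > 0" "b > 0" "c > 0" "d > 0"
  shows "cross_sum (- h) k a b c d \<le> exp (2 * r) * cross_sum h k a b c d"
proof -
  have e: "exp (2 * r) * cross_sum h k a b c d
    = a * exp (2 * r + (- h - k)) + b * exp (2 * r + (k - h)) + c * exp (2 * r + (h - k)) + d * exp (2 * r + (h + k))"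
    unfolding exp_add[of "2 * r"] by (simp add: cross_sum_def algebra_simps)
  show ?thesis
    unfolding e unfolding cross_sum_def using assms by (intro add_mono mult_left_mono) auto
qed

lemma cross_sum_less:
  assumes "a \<le> a'" "b \<le> b'" "c \<le> c'" "d \<le> d'" "a < a' \<or> b < b' \<or> c < c' \<or> d < d'"
  shows "cross_sum h k a b c d < cross_sum h k a' b' c' d'"
proof -
  have le: "a * exp (- h - k) \<le> a' * exp (- h - k)" "b * exp (k - h) \<le> b' * exp (k - h)"
    "c * exp (h - k) \<le> c' * exp (h - k)" "d * exp (h + k) \<le> d' * exp (h + k)"
    using assms by simp_all
  have "a * exp (- h - k) < a' * exp (- h - k) \<or> b * exp (k - h) < b' * exp (k - h)
    \<or> c * exp (h - k) < c' * exp (h - k) \<or> d * exp (h + k) < d' * exp (h + k)"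
    using assms(5) by simp
  with le show ?thesis unfolding cross_sum_def by linarith
qed

text \<open>Taking logarithms, 4 s = ln (q / p), while q / p and p / q are both at most exp (4
  r).\<close>

lemma exp_balance_bound:
  fixes p q r s :: real
  assumes "p > 0" "q > 0" "p * exp (2 * s) = q * exp (- (2 * s))" "q \<le> exp (4 * r) * p" "p \<le> exp (4 * r) * q"
  shows "\<bar>s\<bar> \<le> r"
proof -
  have "2 * s = ln (q / p) / 2" using exp_balance_iff assms by simp
  moreover have "ln (q / p) \<le> 4 * r"
  proof -
    have "q / p \<le> exp (4 * r)" using assms by (simp add: divide_le_eq)
    then show ?thesis using ln_le_cancel_iff[of "q / p" "exp (4 * r)"] assms by simp
  qed
  moreover have "ln (p / q) \<le> 4 * r"
  proof -
    have "p / q \<le> exp (4 * r)" using assms by (simp add: divide_le_eq)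
    then show ?thesis using ln_le_cancel_iff[of "p / q" "exp (4 * r)"] assms by simp
  qed
  moreover have "ln (p / q) = - ln (q / p)" using assms by (simp add: ln_div)
  ultimately show ?thesis by simp
qed

text \<open>The minimum 2 sqrt (\<alpha> \<delta>) + 2 sqrt (\<beta> \<gamma>) for coefficients of
  the form cross sum / (4 sinh (2 h) sinh (2 k)).\<close>

definition transversal_cosh :: "real \<Rightarrow> real \<Rightarrow> real \<Rightarrow> real \<Rightarrow> real \<Rightarrow> real \<Rightarrow> real" where
  "transversal_cosh x y a b c d = (let h = arcosh x / 2; k = arcosh y / 2 in
     (sqrt (cross_sum h k a b c d * cross_sum (- h) (- k) a b c d)
      + sqrt (cross_sum h (- k) a b c d * cross_sum (- h) k a b c d))
     / (2 * sinh (2 * h) * sinh (2 * k)))"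

text \<open>Exchanging the ends of one edge flips the sign of its half-length in every cross sum,
  which exchanges the two radicands.\<close>

lemma transversal_cosh_swap:
  "transversal_cosh x y b a d c = transversal_cosh x y a b c d"
  "transversal_cosh x y c d a b = transversal_cosh x y a b c d"
  by (simp_all add: transversal_cosh_def cross_sum_flip[of _ _ b a d c] cross_sum_flip(2)[of _ _ c d a b]
      Let_def algebra_simps)

text \<open>Every factor under the roots is positive and strictly increases, while the denominator
  depends on x and y only.\<close>

lemma transversal_cosh_less:
  assumes "x > 1" "y > 1" and pos: "a > 0" "b > 0" "c > 0" "d > 0"
    and le: "a \<le> a'" "b \<le> b'" "c \<le> c'" "d \<le> d'" "a < a' \<or> b < b' \<or> c < c' \<or> d < d'"
  shows "transversal_cosh x y a b c d < transversal_cosh x y a' b' c' d'"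
proof -
  have pos': "a' > 0" "b' > 0" "c' > 0" "d' > 0" using pos le by linarith+
  have prod: "cross_sum h k a b c d * cross_sum h' k' a b c d
      < cross_sum h k a' b' c' d' * cross_sum h' k' a' b' c' d'" for h k h' k'
    using cross_sum_less[OF le] cross_sum_pos[OF pos] cross_sum_pos[OF pos']
    by (intro mult_strict_mono) (auto simp: less_imp_le)
  show ?thesis
    unfolding transversal_cosh_def Let_def using assms(1,2)
    by (intro divide_strict_right_mono add_strict_mono real_sqrt_less_mono prod) simp
qed

text \<open>Negative cross products make all four exponential coefficients positive. The parameter
  bounds come from combining the two balance equations at the critical point into one equation in s
  alone and one in t alone.\<close>

lemma transversal_of_edges:
  assumes mn: "ultraparallel m n" and kl: "ultraparallel k l"
    and cross: "lorentz m k < 0" "lorentz m l < 0" "lorentz n k < 0" "lorentz n l < 0"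
  defines "G \<equiv> \<lambda>z. - lorentz (edge_point m n (fst z)) (edge_point k l (snd z))"
  obtains s t where "\<forall>z. critical_point G z \<longleftrightarrow> z = (s, t)" "\<forall>z. G (s, t) \<le> G z"
    "G (s, t) = transversal_cosh (- lorentz m n) (- lorentz k l)
       (- lorentz m k) (- lorentz m l) (- lorentz n k) (- lorentz n l)"
    "\<bar>s\<bar> \<le> half_length m n" "\<bar>t\<bar> \<le> half_length k l"
proof -
  interpret mn: ultraparallel_pair m n by unfold_locales (rule mn)
  interpret kl: ultraparallel_pair k l by unfold_locales (rule kl)
  define a b c d where "a = - lorentz m k" and "b = - lorentz m l"
    and "c = - lorentz n k" and "d = - lorentz n l"
  have pos: "a > 0" "b > 0" "c > 0" "d > 0" using cross by (auto simp: a_def b_def c_def d_def)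
  define S where "S = 4 * sinh (2 * mn.h) * sinh (2 * kl.h)"
  have S: "S > 0" using mn.sinh_pos kl.sinh_pos by (simp add: S_def)
  let ?E = "\<lambda>h k. cross_sum h k a b c d"
  have E: "?E h k > 0" for h k by (rule cross_sum_pos[OF pos])
  have G: "G z = ?E mn.h kl.h / S * exp (fst z + snd z) + ?E mn.h (- kl.h) / S * exp (fst z - snd z)
      + ?E (- mn.h) kl.h / S * exp (snd z - fst z) + ?E (- mn.h) (- kl.h) / S * exp (- fst z - snd z)" for z
  proof -
    let ?s = "fst z" and ?t = "snd z"
    have "G z = (a * (cosh (?s - mn.h) * cosh (?t - kl.h)) + b * (cosh (?s - mn.h) * cosh (?t + kl.h))
       + c * (cosh (?s + mn.h) * cosh (?t - kl.h)) + d * (cosh (?s + mn.h) * cosh (?t + kl.h)))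
       / (sinh (2 * mn.h) * sinh (2 * kl.h))"
      using mn.sinh_pos kl.sinh_pos
      unfolding G_def edge_point_def lorentz_simps a_def b_def c_def d_def by (simp add: field_simps)
    then show ?thesis unfolding cross_sum_cosh S_def by (simp add: add_divide_distrib)
  qed
  obtain s t where st: "\<And>z. critical_point G z \<longleftrightarrow> z = (s, t)" "\<And>z. G (s, t) \<le> G z"
    "G (s, t) = 2 * sqrt (?E mn.h kl.h / S * (?E (- mn.h) (- kl.h) / S))
      + 2 * sqrt (?E mn.h (- kl.h) / S * (?E (- mn.h) kl.h / S))"
    "?E mn.h kl.h / S * exp (s + t) = ?E (- mn.h) (- kl.h) / S * exp (- s - t)"
    "?E mn.h (- kl.h) / S * exp (s - t) = ?E (- mn.h) kl.h / S * exp (t - s)"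
    unfolding G[abs_def]
    by (rule exp_sum_critical_point[of "?E mn.h kl.h / S" "?E mn.h (- kl.h) / S"
          "?E (- mn.h) kl.h / S" "?E (- mn.h) (- kl.h) / S"]) (use E S in simp_all)
  have bal: "?E mn.h kl.h * exp (s + t) = ?E (- mn.h) (- kl.h) * exp (- s - t)"
    "?E mn.h (- kl.h) * exp (s - t) = ?E (- mn.h) kl.h * exp (t - s)"
    using st(4,5) S by simp_all
  have val: "G (s, t) = transversal_cosh (- lorentz m n) (- lorentz k l) a b c d"
  proof -
    have "sqrt (x / S * (y / S)) = sqrt (x * y) / S" for x y
      using S by (simp add: real_sqrt_mult real_sqrt_divide)
    then show ?thesis
      unfolding st(3) transversal_cosh_def Let_def half_length_def[symmetric] S_def
      by (simp add: add_divide_distrib mult_ac)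
  qed
  \<comment> \<open>The bound for k is the bound for h with the roles of the two edges
    exchanged.\<close>
  have flip: "?E (- h) k \<le> exp (2 * \<bar>h\<bar>) * ?E h k" "?E h (- k) \<le> exp (2 * \<bar>k\<bar>) * ?E h k" for h k
    using cross_sum_flip_le[of h "\<bar>h\<bar>" a b c d k] cross_sum_flip_le[of k "\<bar>k\<bar>" a c b d h] pos
    by (simp_all add: cross_sum_swap[of h _ a b c d])
  have exp4: "exp (4 * r) = exp (2 * r) * exp (2 * r)" for r :: real
    by (simp add: exp_add[symmetric])
  have flip_prod: "x * y \<le> exp (4 * r) * (u * v)"
    if "x \<le> exp (2 * r) * u" "y \<le> exp (2 * r) * v" "x > 0" "y > 0" "u > 0" "v > 0" for x y u v r :: real
  proof -
    have "x * y \<le> (exp (2 * r) * u) * (exp (2 * r) * v)" using that by (intro mult_mono) auto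
    then show ?thesis unfolding exp4 by (simp add: mult_ac)
  qed
  have hk: "\<bar>mn.h\<bar> = mn.h" "\<bar>kl.h\<bar> = kl.h" using mn.h_pos kl.h_pos by auto
  \<comment> \<open>Multiplying the two balance equations eliminates t; multiplying the first by the
    reversed second eliminates s.\<close>
  have e: "exp (s + t) * exp (s - t) = exp (2 * s)" "exp (- s - t) * exp (t - s) = exp (- (2 * s))"
    "exp (s + t) * exp (t - s) = exp (2 * t)" "exp (- s - t) * exp (s - t) = exp (- (2 * t))"
    by (simp_all add: exp_add[symmetric])
  have s: "\<bar>s\<bar> \<le> mn.h"
  proof (rule exp_balance_bound)
    show "?E mn.h kl.h * ?E mn.h (- kl.h) * exp (2 * s)
      = ?E (- mn.h) (- kl.h) * ?E (- mn.h) kl.h * exp (- (2 * s))"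
      using arg_cong2[OF bal, of "(*)"] unfolding e[symmetric] by (simp add: mult_ac)
    show "?E (- mn.h) (- kl.h) * ?E (- mn.h) kl.h \<le> exp (4 * mn.h) * (?E mn.h kl.h * ?E mn.h (- kl.h))"
      using flip_prod[OF flip(1)[of mn.h "- kl.h"] flip(1)[of mn.h kl.h], unfolded hk] E
      by (simp add: mult_ac)
    show "?E mn.h kl.h * ?E mn.h (- kl.h) \<le> exp (4 * mn.h) * (?E (- mn.h) (- kl.h) * ?E (- mn.h) kl.h)"
      using flip_prod[OF flip(1)[of "- mn.h" kl.h] flip(1)[of "- mn.h" "- kl.h"], unfolded abs_minus_cancel minus_minus hk] E
      by (simp add: mult_ac)
  qed (use E in simp_all)
  have t: "\<bar>t\<bar> \<le> kl.h"
  proof (rule exp_balance_bound)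
    show "?E mn.h kl.h * ?E (- mn.h) kl.h * exp (2 * t)
      = ?E (- mn.h) (- kl.h) * ?E mn.h (- kl.h) * exp (- (2 * t))"
      using arg_cong2[OF bal(1) bal(2)[symmetric], of "(*)"] unfolding e[symmetric] by (simp add: mult_ac)
    show "?E (- mn.h) (- kl.h) * ?E mn.h (- kl.h) \<le> exp (4 * kl.h) * (?E mn.h kl.h * ?E (- mn.h) kl.h)"
      using flip_prod[OF flip(2)[of "- mn.h" "kl.h"] flip(2)[of mn.h kl.h], unfolded hk] E
      by (simp add: mult_ac)
    show "?E mn.h kl.h * ?E (- mn.h) kl.h \<le> exp (4 * kl.h) * (?E (- mn.h) (- kl.h) * ?E mn.h (- kl.h))"
      using flip_prod[OF flip(2)[of mn.h "- kl.h"] flip(2)[of "- mn.h" "- kl.h"], unfolded abs_minus_cancel minus_minus hk] E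
      by (simp add: mult_ac)
  qed (use E in simp_all)
  show thesis
    by (rule that[OF _ _ val[unfolded a_def b_def c_def d_def] s t]) (simp_all only: st(1,2) simp_thms)
qed

section \<open>Edges of a truncated tetrahedron\<close>

lemma hset_dist_commute: "hset_dist A B = hset_dist B A"
proof -
  have "{hdist x y | x y. x \<in> A \<and> y \<in> B} = {hdist x y | x y. x \<in> B \<and> y \<in> A}"
    unfolding hdist_def by (subst lorentz_commute) blast
  then show ?thesis by (simp add: hset_dist_def)
qed

lemma edge_length_commute: "edge_length P i j = edge_length P j i"
  by (simp add: edge_length_def hset_dist_commute)

text \<open>The slope is read off from the images of 0 and 1; the distances to these two images then
  determine \<open>f s\<close>.\<close>

lemma real_isometry:
  fixes f :: "real \<Rightarrow> real"
  assumes "\<And>s t. \<bar>f s - f t\<bar> = \<bar>s - t\<bar>"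
  obtains \<sigma> where "\<bar>\<sigma>\<bar> = 1" "\<forall>s. f s = \<sigma> * s + f 0"
proof -
  define \<sigma> where "\<sigma> = f 1 - f 0"
  have \<sigma>: "\<bar>\<sigma>\<bar> = 1" using assms[of 1 0] by (simp add: \<sigma>_def)
  have "f s = \<sigma> * s + f 0" for s
  proof -
    define x where "x = f s - f 0"
    have "\<bar>x\<bar> = \<bar>s\<bar>" "\<bar>x - \<sigma>\<bar> = \<bar>s - 1\<bar>"
      using assms[of s 0] assms[of s 1] by (simp_all add: \<sigma>_def x_def)
    then have x: "x = s \<or> x = - s" "x - \<sigma> = s - 1 \<or> x - \<sigma> = - (s - 1)"
      by (auto simp only: abs_eq_iff)
    have "\<sigma> = 1 \<or> \<sigma> = - 1" using \<sigma> by linarith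
    then have "x = \<sigma> * s"
    proof
      assume s1: "\<sigma> = 1"
      have "x = s" using x unfolding s1 by (elim disjE) linarith+
      then show ?thesis using s1 by simp
    next
      assume s1: "\<sigma> = - 1"
      have "x = - s" using x unfolding s1 by (elim disjE) linarith+
      then show ?thesis using s1 by simp
    qed
    then show ?thesis by (simp add: x_def)
  qed
  with \<sigma> show thesis by (intro that[of \<sigma>]) blast+
qed

text \<open>The transition from the midpoint parametrization to any other one is an isometry of the
  real line, so critical points may be computed in the explicit coordinates.\<close>

lemma (in ultraparallel_pair) arclength_parametrization_edge:
  assumes "arclength_parametrization (range c) \<gamma>"
  obtains \<sigma> \<tau> where "\<bar>\<sigma>\<bar> = 1" "\<forall>s. \<gamma> s = c (\<sigma> * s + \<tau>)"
proof -
  have "\<forall>s. \<exists>r. \<gamma> s = c r"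
    using assms unfolding arclength_parametrization_def by blast
  from choice[OF this] obtain f where f: "\<forall>s. \<gamma> s = c (f s)" ..
  have isometry: "\<bar>f s - f t\<bar> = \<bar>s - t\<bar>" for s t
  proof -
    have "hdist (\<gamma> s) (\<gamma> t) = \<bar>s - t\<bar>"
      using assms unfolding arclength_parametrization_def by blast
    then show ?thesis by (simp only: f[rule_format] hdist_edge_points)
  qed
  obtain \<sigma> where \<sigma>: "\<bar>\<sigma>\<bar> = 1" "\<forall>s. f s = \<sigma> * s + f 0" by (rule real_isometry[OF isometry])
  show thesis
    by (rule that[OF \<sigma>(1)], rule allI) (subst f[rule_format], subst \<sigma>(2)[rule_format], rule refl)
qed

lemma critical_point_affine:
  fixes G :: "real \<times> real \<Rightarrow> real" and \<sigma> \<tau> \<sigma>' \<tau>' :: real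
  assumes "\<sigma> \<noteq> 0" "\<sigma>' \<noteq> 0"
  defines "A \<equiv> \<lambda>z. (\<sigma> * fst z + \<tau>, \<sigma>' * snd z + \<tau>')"
  shows "critical_point (\<lambda>z. G (A z)) z \<longleftrightarrow> critical_point G (A z)"
proof
  \<comment> \<open>The chain rule gives one direction; the converse is the same fact for the
    inverse affine map.\<close>
  have *: "critical_point (\<lambda>z. G (a * fst z + b, a' * snd z + b')) z"
    if "critical_point G (a * fst z + b, a' * snd z + b')" for a b a' b' and G :: "real \<times> real \<Rightarrow> real" and z
  proof -
    have "((\<lambda>z. (a * fst z + b, a' * snd z + b')) has_derivative (\<lambda>z. (a * fst z, a' * snd z))) (at z)"
      by (auto intro!: derivative_eq_intros)
    from has_derivative_compose[OF this that[unfolded critical_point_def]] show ?thesis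
      by (simp add: critical_point_def)
  qed
  show "critical_point G (A z) \<Longrightarrow> critical_point (\<lambda>z. G (A z)) z"
    unfolding A_def by (rule *)
  have inv: "A ((1 / \<sigma>) * fst w + - \<tau> / \<sigma>, (1 / \<sigma>') * snd w + - \<tau>' / \<sigma>') = w" for w
    using assms(1,2) by (cases w) (simp add: A_def field_simps)
  have "((1 / \<sigma>) * fst (A z) + - \<tau> / \<sigma>, (1 / \<sigma>') * snd (A z) + - \<tau>' / \<sigma>') = z"
    using assms(1,2) by (cases z) (simp add: A_def field_simps)
  then show "critical_point (\<lambda>z. G (A z)) z \<Longrightarrow> critical_point G (A z)"
    using *[of "\<lambda>z. G (A z)" "1 / \<sigma>" "A z" "- \<tau> / \<sigma>" "1 / \<sigma>'" "- \<tau>' / \<sigma>'"] by (simp only: inv)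
qed

lemma hplane_subset_half:
  assumes "hplane P" "half H3 P H"
  shows "P \<subseteq> H"
  using assms by (rule hplane_half_normal) auto

section \<open>Configurations of four facing planes\<close>

locale facing_planes =
  fixes P H n
  assumes facing: "facing_normals P H n"
begin

lemma P_eq: "i \<in> {1..4} \<Longrightarrow> P i = {x \<in> H3. lorentz x (n i) = 0}"
  by (rule facing[unfolded facing_normals_def, THEN bspec, THEN conjunct1])

lemma H_eq: "i \<in> {1..4} \<Longrightarrow> H i = {x \<in> H3. lorentz x (n i) \<le> 0}"
  by (rule facing[unfolded facing_normals_def, THEN bspec, THEN conjunct2, THEN conjunct1])

lemma ultra:
  assumes "i \<in> {1..4}" "j \<in> {1..4}" "i \<noteq> j"
  shows "ultraparallel (n i) (n j)"
  by (rule facing[unfolded facing_normals_def, THEN bspec, THEN conjunct2, THEN conjunct2, THEN bspec])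
    (use assms in blast)+

lemma lorentz_less: "i \<in> {1..4} \<Longrightarrow> j \<in> {1..4} \<Longrightarrow> i \<noteq> j \<Longrightarrow> lorentz (n i) (n j) < - 1"
  using ultra[of i j] by (simp add: ultraparallel_def)

lemma internal_edge_eq:
  assumes "i \<in> {1..4}" "j \<in> {1..4}" "i \<noteq> j"
  shows "internal_edge P i j = edge_point (n i) (n j) ` {- half_length (n i) (n j)..half_length (n i) (n j)}"
proof -
  interpret ultraparallel_pair "n i" "n j" by unfold_locales (rule ultra[OF assms])
  show ?thesis
    unfolding internal_edge_def P_eq[OF assms(1)] P_eq[OF assms(2)] shortest_arc_planes
    by (auto simp: hsegment_foot_points)
qed

lemma internal_edge_commute:
  assumes "i \<in> {1..4}" "j \<in> {1..4}" "i \<noteq> j"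
  shows "internal_edge P i j \<subseteq> internal_edge P j i"
proof -
  have "edge_point (n i) (n j) s = edge_point (n j) (n i) (- s)" for s
    by (rule edge_point_sym)
  then show ?thesis
    using internal_edge_eq[OF assms] internal_edge_eq[OF assms(2,1)] assms(3)
      half_length_sym[of "n i" "n j"] by force
qed

lemma cosh_edge_length:
  assumes "i \<in> {1..4}" "j \<in> {1..4}" "i \<noteq> j"
  shows "cosh (edge_length P i j) = - lorentz (n i) (n j)"
proof -
  interpret ultraparallel_pair "n i" "n j" by unfold_locales (rule ultra[OF assms])
  show ?thesis
    unfolding edge_length_def P_eq[OF assms(1)] P_eq[OF assms(2)] hset_dist_planes
    by (simp add: lorentz_normals)
qed

lemma internal_edge_conic:
  assumes "i \<in> {1..4}" "j \<in> {1..4}" "i \<noteq> j" "z \<in> internal_edge P i j"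
  obtains a b where "a > 0" "b > 0" "z = a *\<^sub>R n i + b *\<^sub>R n j"
proof -
  interpret ultraparallel_pair "n i" "n j" by unfold_locales (rule ultra[OF assms(1-3)])
  obtain s where "z = c s" using assms internal_edge_eq by auto
  then have "z = (cosh (s - h) / sinh (2 * h)) *\<^sub>R n i + (cosh (s + h) / sinh (2 * h)) *\<^sub>R n j"
    by (simp add: edge_point_def scaleR_right_distrib)
  then show thesis using sinh_pos by (intro that) simp_all
qed

lemma internal_edge_H3:
  assumes "i \<in> {1..4}" "j \<in> {1..4}" "i \<noteq> j"
  shows "internal_edge P i j \<subseteq> H3"
proof -
  interpret ultraparallel_pair "n i" "n j" by unfold_locales (rule ultra[OF assms])
  show ?thesis using internal_edge_eq[OF assms] edge_point_H3 by auto
qed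

text \<open>For \<open>m\<close> equal to \<open>i\<close> or \<open>j\<close> this is the sign of
  the signed distance on [- h, h]. For any other \<open>m\<close>, the point is a positive
  combination of two normals whose products with \<open>n m\<close> are negative.\<close>

lemma internal_edge_half_space:
  assumes ij: "i \<in> {1..4}" "j \<in> {1..4}" "i \<noteq> j" and m: "m \<in> {1..4}"
  shows "internal_edge P i j \<subseteq> H m"
proof
  fix z assume z: "z \<in> internal_edge P i j"
  interpret ultraparallel_pair "n i" "n j" by unfold_locales (rule ultra[OF ij])
  obtain s where s: "z = c s" "s \<in> {- h..h}" using z internal_edge_eq[OF ij] by auto
  obtain a b where ab: "a > 0" "b > 0" "z = a *\<^sub>R n i + b *\<^sub>R n j"
    using internal_edge_conic[OF ij z] by blast
  have "lorentz z (n m) \<le> 0"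
  proof (cases "m = i \<or> m = j")
    case True
    then show ?thesis using s lorentz_edge_point_normal by auto
  next
    case False
    then have "lorentz (n i) (n m) < 0" "lorentz (n j) (n m) < 0"
      using lorentz_less[OF ij(1) m] lorentz_less[OF ij(2) m] by auto
    then have "a * lorentz (n i) (n m) < 0" "b * lorentz (n j) (n m) < 0"
      using ab by (simp_all add: mult_pos_neg)
    then show ?thesis unfolding ab(3) lorentz_simps by linarith
  qed
  then show "z \<in> H m" using H_eq[OF m] internal_edge_H3[OF ij] z by auto
qed

text \<open>Each foot of an edge at \<open>P c\<close> is a positive combination of two normals, so the linear form
  cutting out \<open>h\<close> in \<open>Q\<close>, which vanishes on the normals of \<open>P a\<close> and \<open>P b\<close>, is nonnegative on
  the other two normals and hence on every edge.\<close>

lemma internal_edge_edge_half_plane: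
  assumes abcd: "{a, b, c, d} = {1..4}" "distinct [a, b, c, d]"
    and Q: "hplane Q" "\<And>m. m \<in> {1..4} \<Longrightarrow> planes_perp Q (P m)"
    and h: "edge_half_plane Q (P a) (P b) (P c) (P d) h"
    and ij: "i \<in> {1..4}" "j \<in> {1..4}" "i \<noteq> j"
  shows "internal_edge P i j \<subseteq> h \<inter> Q"
proof
  have mem: "a \<in> {1..4}" "b \<in> {1..4}" "c \<in> {1..4}" "d \<in> {1..4}" using abcd(1) by blast+
  obtain N where N: "Q = {x \<in> H3. lorentz x N = 0}" "dim {x. lorentz x N = 0} = 3"
    using Q(1) by (rule hplane_normal)
  define V where "V = {x. lorentz x N = 0}"
  have nV: "n m \<in> V" if "m \<in> {1..4}" for m
  proof -
    have "planes_perp {x \<in> H3. lorentz x N = 0} {x \<in> H3. lorentz x (n m) = 0}"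
      using Q(2)[OF that] P_eq[OF that] N(1) by simp
    then have "lorentz N (n m) = 0" by (rule planes_perp_normals)
    then show ?thesis by (simp add: V_def lorentz_commute)
  qed
  have V: "subspace V" unfolding V_def by (rule subspace_lorentz_orthogonal)
  have QV: "Q = V \<inter> H3" using N(1) by (auto simp: V_def)
  obtain L where L: "common_perpendicular (P a) (P b) L" "half Q L h"
    and ch: "P c \<inter> Q \<subseteq> h" and dh: "P d \<inter> Q \<subseteq> h"
    using h unfolding edge_half_plane_def by blast
  have ab: "ultraparallel (n a) (n b)" using abcd mem by (intro ultra) auto
  have Leq: "L = span {n a, n b} \<inter> H3" and dim: "dim (span {n a, n b}) = 2"
    using common_perpendicular_eq[OF ab] L(1) P_eq mem by auto
  have WV: "span {n a, n b} \<subseteq> V" using nV mem by (intro span_minimal V) auto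
  have dimV: "dim V = dim (span {n a, n b}) + 1" using N(2) dim by (simp add: V_def)
  have half: "half (V \<inter> H3) (span {n a, n b} \<inter> H3) h" using L(2) QV Leq by simp
  obtain w where w: "span {n a, n b} = {x \<in> V. w \<bullet> x = 0}" "h = {x \<in> V \<inter> H3. w \<bullet> x \<ge> 0}"
    by (rule half_eq[OF V subspace_span WV dimV half])
  have "n a \<in> span {n a, n b}" "n b \<in> span {n a, n b}" by (simp_all add: span_base)
  then have wab: "w \<bullet> n a = 0" "w \<bullet> n b = 0" using w(1) by auto
  have foot: "w \<bullet> n e \<ge> 0" if e: "e \<in> {1..4}" "e \<noteq> a" "P e \<inter> Q \<subseteq> h" for e
  proof -
    interpret ultraparallel_pair "n e" "n a" using e mem by unfold_locales (intro ultra)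
    \<comment> \<open>The edge towards \<open>P a\<close> is taken because \<open>w\<close> vanishes
      on \<open>n a\<close>: at the foot on \<open>P e\<close> the form is then a positive multiple
      of its value at \<open>n e\<close>.\<close>
    let ?u = "edge_point (n e) (n a) (- half_length (n e) (n a))"
    have "span {n e, n a} \<subseteq> V" using nV e mem by (intro span_minimal V) auto
    then have "?u \<in> Q" using edge_point_in_span edge_point_H3 QV by blast
    moreover have "?u \<in> P e" using foot_points(1) P_eq[OF e(1)] by simp
    ultimately have "?u \<in> h" using e by blast
    then have "w \<bullet> ?u \<ge> 0" using w(2) by simp
    then have "cosh (2 * half_length (n e) (n a)) * (w \<bullet> n e) / sinh (2 * half_length (n e) (n a)) \<ge> 0"
      using wab cosh_minus[of "2 * half_length (n e) (n a)"]
      by (simp add: edge_point_def inner_simps)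
    then show ?thesis 
      using sinh_pos by (simp add: zero_le_divide_iff zero_le_mult_iff not_le[THEN iffD2, OF cosh_real_pos])
  qed
  have wn: "w \<bullet> n m \<ge> 0" if "m \<in> {1..4}" for m
  proof -
    have "m = a \<or> m = b \<or> m = c \<or> m = d" using that abcd(1) by blast
    moreover have "w \<bullet> n c \<ge> 0" "w \<bullet> n d \<ge> 0"
      using foot[OF mem(3) _ ch] foot[OF mem(4) _ dh] abcd(2) by auto
    ultimately show ?thesis using wab by auto
  qed
  fix z assume z: "z \<in> internal_edge P i j"
  obtain \<alpha> \<beta> where "\<alpha> > 0" "\<beta> > 0" "z = \<alpha> *\<^sub>R n i + \<beta> *\<^sub>R n j"
    using internal_edge_conic[OF ij z] by blast
  moreover from this have "z \<in> V"
    using nV[OF ij(1)] nV[OF ij(2)] V by (simp add: subspace_add subspace_scale)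
  moreover have "z \<in> H3" using internal_edge_H3[OF ij] z by blast
  ultimately show "z \<in> h \<inter> Q"
    using wn[OF ij(1)] wn[OF ij(2)] by (simp add: w(2) QV inner_simps)
qed

text \<open>For \<open>m\<close> other than \<open>i\<close> and \<open>j\<close>, the normal of
  \<open>P_hat m\<close> is orthogonal to \<open>n i\<close> and \<open>n j\<close>, so the edge
  lies in the boundary plane of \<open>H_hat m\<close>. For the remaining \<open>m\<close> the
  definition of \<open>H_hat m\<close> already demands the edge. In the degenerate case the
  half-plane lemma applies to each of the four sides, whatever the renumbering
  \<open>r\<close>.\<close>

lemma internal_edge_truncated_tetrahedron:
  assumes \<Delta>: "truncated_tetrahedron P H \<Delta>" and ij: "i \<in> {1..4}" "j \<in> {1..4}" "i \<noteq> j"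
  shows "internal_edge P i j \<subseteq> \<Delta>"
proof -
  obtain P_hat where P_hat: "\<forall>i\<in>{1..4}. hplane (P_hat i) \<and>
        (\<forall>j\<in>{1..4} - {i}. planes_perp (P_hat i) (P j))"
    and cases: "if \<exists>i\<in>{1..4}. \<not> planes_perp (P_hat i) (P i)
         then nondegenerate_tetrahedron P H P_hat \<Delta>
         else \<exists>Q. (\<forall>i\<in>{1..4}. P_hat i = Q) \<and> degenerate_tetrahedron P H Q \<Delta>"
    using \<Delta> unfolding truncated_tetrahedron_def by blast
  have hp: "hplane (P_hat m)" if "m \<in> {1..4}" for m using P_hat that by blast
  have perp: "planes_perp (P_hat m) (P k)" if "m \<in> {1..4}" "k \<in> {1..4}" "k \<noteq> m" for m k
    using P_hat that by blast
  have H: "internal_edge P i j \<subseteq> (\<Inter>m\<in>{1..4}. H m)"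
    using internal_edge_half_space[OF ij] by blast
  show ?thesis
  proof (cases "\<exists>i\<in>{1..4}. \<not> planes_perp (P_hat i) (P i)")
    case True
    then have "nondegenerate_tetrahedron P H P_hat \<Delta>" using cases by argo
    then obtain H_hat where hh: "\<And>m. m \<in> {1..4} \<Longrightarrow> half H3 (P_hat m) (H_hat m)"
      "\<And>m k. \<lbrakk>m \<in> {1..4}; k \<in> {1..4} - {m}\<rbrakk> \<Longrightarrow> internal_edge P k m \<subseteq> H_hat m"
      and \<Delta>_eq: "\<Delta> = (\<Inter>i\<in>{1..4}. H i) \<inter> (\<Inter>i\<in>{1..4}. H_hat i)"
      unfolding nondegenerate_tetrahedron_def by blast
    have "internal_edge P i j \<subseteq> H_hat m" if m: "m \<in> {1..4}" for m
    proof (cases "m = i \<or> m = j")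
      case True
      then show ?thesis
        using hh(2)[of i j] hh(2)[of j i] internal_edge_commute[OF ij] ij by blast
    next
      case False
      obtain N where N: "P_hat m = {x \<in> H3. lorentz x N = 0}"
        using hp[OF m] by (rule hplane_normal)
      have N_perp: "lorentz (n k) N = 0" if "k \<in> {1..4}" "k \<noteq> m" for k
      proof -
        have "lorentz N (n k) = 0"
          using perp[OF m that] unfolding N P_eq[OF that(1)] by (rule planes_perp_normals)
        then show ?thesis by (simp add: lorentz_commute)
      qed
      have "internal_edge P i j \<subseteq> P_hat m"
      proof
        fix z assume z: "z \<in> internal_edge P i j"
        obtain a b where "z = a *\<^sub>R n i + b *\<^sub>R n j" using internal_edge_conic[OF ij z] by blast
        then have "lorentz z N = 0" using N_perp ij False by (simp add: lorentz_simps)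
        then show "z \<in> P_hat m" using N internal_edge_H3[OF ij] z by blast
      qed
      then show ?thesis using hplane_subset_half[OF hp[OF m] hh(1)[OF m]] by blast
    qed
    then show ?thesis using H unfolding \<Delta>_eq by blast
  next
    case False
    then have "\<exists>Q. (\<forall>i\<in>{1..4}. P_hat i = Q) \<and> degenerate_tetrahedron P H Q \<Delta>" using cases by argo
    then obtain Q where Q: "\<And>m. m \<in> {1..4} \<Longrightarrow> P_hat m = Q" "degenerate_tetrahedron P H Q \<Delta>"
      by blast
    have hQ: "hplane Q" using hp[of 1] Q(1)[of 1] by simp
    have pQ: "planes_perp Q (P m)" if "m \<in> {1..4}" for m
      using False Q(1)[OF that] that by blast
    obtain r :: "nat \<Rightarrow> nat" and h12 h23 h34 h14 where r: "bij_betw r {1..4} {1..4}"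
      and e: "edge_half_plane Q (P (r 1)) (P (r 2)) (P (r 3)) (P (r 4)) h12"
         "edge_half_plane Q (P (r 2)) (P (r 3)) (P (r 1)) (P (r 4)) h23"
         "edge_half_plane Q (P (r 3)) (P (r 4)) (P (r 1)) (P (r 2)) h34"
         "edge_half_plane Q (P (r 1)) (P (r 4)) (P (r 2)) (P (r 3)) h14"
      and \<Delta>_eq: "\<Delta> = Q \<inter> (\<Inter>i\<in>{1..4}. H i) \<inter> h12 \<inter> h23 \<inter> h34 \<inter> h14"
      using Q(2) unfolding degenerate_tetrahedron_def Let_def by blast
    have "{1..4} = {1, 2, 3, 4 :: nat}" by auto
    then have im: "{r 1, r 2, r 3, r 4} = {1..4}" "distinct [r 1, r 2, r 3, r 4]"
      using r unfolding bij_betw_def by (auto simp: inj_on_def)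
    have im': "{r 2, r 3, r 1, r 4} = {1..4}" "{r 3, r 4, r 1, r 2} = {1..4}" "{r 1, r 4, r 2, r 3} = {1..4}"
      "distinct [r 2, r 3, r 1, r 4]" "distinct [r 3, r 4, r 1, r 2]" "distinct [r 1, r 4, r 2, r 3]"
      using im by (simp_all add: insert_commute eq_commute)
    have sub: "internal_edge P i j \<subseteq> h \<inter> Q"
      if "{a, b, c, d} = {1..4}" "distinct [a, b, c, d]" "edge_half_plane Q (P a) (P b) (P c) (P d) h"
      for a b c d h
      by (rule internal_edge_edge_half_plane[OF that(1,2) hQ pQ that(3) ij])
    show ?thesis
      using sub[OF im e(1)] sub[OF im'(1,4) e(2)] sub[OF im'(2,5) e(3)] sub[OF im'(3,6) e(4)] H
      unfolding \<Delta>_eq by blast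
  qed
qed

end

section \<open>Transversals\<close>

definition config_transversal_cosh :: "(nat \<Rightarrow> minkowski set) \<Rightarrow> nat \<Rightarrow> nat \<Rightarrow> nat \<Rightarrow> nat \<Rightarrow> real" where
  "config_transversal_cosh P i j k l =
     transversal_cosh (cosh (edge_length P i j)) (cosh (edge_length P k l))
       (cosh (edge_length P i k)) (cosh (edge_length P i l))
       (cosh (edge_length P j k)) (cosh (edge_length P j l))"

lemma opposite_indicesD:
  assumes "opposite_indices i j k l"
  shows "i \<in> {1..4}" "j \<in> {1..4}" "k \<in> {1..4}" "l \<in> {1..4}"
    and "i \<noteq> j" "k \<noteq> l" "i \<noteq> k" "i \<noteq> l" "j \<noteq> k" "j \<noteq> l"
  using assms unfolding opposite_indices_def by auto

context facing_planes
begin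

lemma transversal:
  assumes opp: "opposite_indices i j k l"
  defines "G \<equiv> \<lambda>z. - lorentz (edge_point (n i) (n j) (fst z)) (edge_point (n k) (n l) (snd z))"
  obtains s t where "\<forall>z. critical_point G z \<longleftrightarrow> z = (s, t)" "\<forall>z. G (s, t) \<le> G z"
    "G (s, t) = config_transversal_cosh P i j k l"
    "edge_point (n i) (n j) s \<in> internal_edge P i j" "edge_point (n k) (n l) t \<in> internal_edge P k l"
    "is_transversal P i j k l (edge_point (n i) (n j) s) (edge_point (n k) (n l) t)"
    "transversal_length P i j k l = arcosh (config_transversal_cosh P i j k l)"
    "config_transversal_cosh P i j k l \<ge> 1"
proof -
  note o = opposite_indicesD[OF opp]
  interpret ij: ultraparallel_pair "n i" "n j" by unfold_locales (rule ultra[OF o(1,2,5)])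
  interpret kl: ultraparallel_pair "n k" "n l" by unfold_locales (rule ultra[OF o(3,4,6)])
  have cross: "lorentz (n i) (n k) < 0" "lorentz (n i) (n l) < 0" "lorentz (n j) (n k) < 0" "lorentz (n j) (n l) < 0"
    using lorentz_less[OF o(1,3,7)] lorentz_less[OF o(1,4,8)] lorentz_less[OF o(2,3,9)]
      lorentz_less[OF o(2,4,10)] by linarith+
  obtain s t where st: "\<forall>z. critical_point G z \<longleftrightarrow> z = (s, t)" "\<forall>z. G (s, t) \<le> G z"
    "G (s, t) = transversal_cosh (- lorentz (n i) (n j)) (- lorentz (n k) (n l))
       (- lorentz (n i) (n k)) (- lorentz (n i) (n l)) (- lorentz (n j) (n k)) (- lorentz (n j) (n l))"
    "\<bar>s\<bar> \<le> ij.h" "\<bar>t\<bar> \<le> kl.h"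
    unfolding G_def by (rule transversal_of_edges[OF ij.ultraparallel kl.ultraparallel cross])
  have val: "G (s, t) = config_transversal_cosh P i j k l"
    unfolding st(3) config_transversal_cosh_def cosh_edge_length[OF o(1,2,5)]
      cosh_edge_length[OF o(3,4,6)] cosh_edge_length[OF o(1,3,7)] cosh_edge_length[OF o(1,4,8)]
      cosh_edge_length[OF o(2,3,9)] cosh_edge_length[OF o(2,4,10)] ..
  have mem: "ij.c s \<in> internal_edge P i j" "kl.c t \<in> internal_edge P k l"
    unfolding internal_edge_eq[OF o(1,2,5)] internal_edge_eq[OF o(3,4,6)]
    using st(4,5) by (intro imageI; simp add: abs_le_iff)+
  \<comment> \<open>The minimum over the two full geodesics is attained on the edges, so it is also
    the minimum over the edges.\<close>
  have arc: "shortest_arc (internal_edge P i j) (internal_edge P k l) (ij.c s) (kl.c t)"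
    unfolding shortest_arc_def
  proof (intro conjI ballI mem)
    fix x y assume x: "x \<in> internal_edge P i j" and y: "y \<in> internal_edge P k l"
    obtain s' where s': "x = ij.c s'" using x unfolding internal_edge_eq[OF o(1,2,5)] by blast
    obtain t' where t': "y = kl.c t'" using y unfolding internal_edge_eq[OF o(3,4,6)] by blast
    have "G (s, t) \<le> G (s', t')" by (rule st(2)[rule_format])
    then show "hdist (ij.c s) (kl.c t) \<le> hdist x y"
      unfolding s' t' G_def hdist_le_iff[OF ij.edge_point_H3 kl.edge_point_H3 ij.edge_point_H3 kl.edge_point_H3]
      by simp
  qed
  have "transversal_length P i j k l = hdist (ij.c s) (kl.c t)"
    unfolding transversal_length_def
    by (rule hset_dist_eq[OF internal_edge_H3[OF o(1,2,5)] internal_edge_H3[OF o(3,4,6)] arc])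
  also have "\<dots> = arcosh (config_transversal_cosh P i j k l)"
    unfolding val[symmetric] by (simp add: hdist_def G_def)
  finally have len: "transversal_length P i j k l = arcosh (config_transversal_cosh P i j k l)" .
  \<comment> \<open>On [1, \<infinity>) the function \<open>arcosh\<close> is inverted by
    \<open>cosh\<close> and strictly increasing; both facts are applied to this value later.\<close>
  have ge1: "config_transversal_cosh P i j k l \<ge> 1"
    unfolding val[symmetric] using H3_lorentz_le[OF ij.edge_point_H3[of s] kl.edge_point_H3[of t]]
    by (simp add: G_def)
  show thesis
    by (rule that[unfolded is_transversal_def, OF _ _ val mem arc len ge1]) (rule st(1,2))+
qed

lemma common_perpendicular_range:
  assumes "i \<in> {1..4}" "j \<in> {1..4}" "i \<noteq> j" "common_perpendicular (P i) (P j) L"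
  shows "L = range (edge_point (n i) (n j))"
proof -
  interpret ultraparallel_pair "n i" "n j" by unfold_locales (rule ultra[OF assms(1-3)])
  have "L = span {n i, n j} \<inter> H3"
    by (rule common_perpendicular_eq(1)[OF ultraparallel])
      (use assms(4) in \<open>simp only: P_eq[OF assms(1)] P_eq[OF assms(2)]\<close>)
  then show ?thesis unfolding span_H3 .
qed

lemma transversal_parametrized:
  assumes opp: "opposite_indices i j k l"
    and L: "common_perpendicular (P i) (P j) L" "common_perpendicular (P k) (P l) L'"
    and par: "arclength_parametrization L \<gamma>" "arclength_parametrization L' \<eta>"
  defines "D \<equiv> \<lambda>(s, t). cosh (hdist (\<gamma> s) (\<eta> t))"
  obtains s t where "\<forall>z. critical_point D z \<longleftrightarrow> z = (s, t)" "\<forall>z. D (s, t) \<le> D z"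
    "D (s, t) = config_transversal_cosh P i j k l"
    "\<gamma> s \<in> internal_edge P i j" "\<eta> t \<in> internal_edge P k l"
    "is_transversal P i j k l (\<gamma> s) (\<eta> t)"
    "D (s, t) = cosh (transversal_length P i j k l)"
proof -
  note o = opposite_indicesD[OF opp]
  interpret ij: ultraparallel_pair "n i" "n j" by unfold_locales (rule ultra[OF o(1,2,5)])
  interpret kl: ultraparallel_pair "n k" "n l" by unfold_locales (rule ultra[OF o(3,4,6)])
  define G where "G = (\<lambda>z. - lorentz (ij.c (fst z)) (kl.c (snd z)))"
  obtain s t where st: "\<forall>z. critical_point G z \<longleftrightarrow> z = (s, t)" "\<forall>z. G (s, t) \<le> G z"
    "G (s, t) = config_transversal_cosh P i j k l"
    "ij.c s \<in> internal_edge P i j" "kl.c t \<in> internal_edge P k l"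
    "is_transversal P i j k l (ij.c s) (kl.c t)"
    "transversal_length P i j k l = arcosh (config_transversal_cosh P i j k l)"
    "config_transversal_cosh P i j k l \<ge> 1"
    unfolding G_def by (rule transversal[OF opp])
  have par': "arclength_parametrization (range ij.c) \<gamma>" "arclength_parametrization (range kl.c) \<eta>"
    using par common_perpendicular_range[OF o(1,2,5) L(1)] common_perpendicular_range[OF o(3,4,6) L(2)]
    by simp_all
  obtain \<sigma> \<tau> where \<gamma>: "\<bar>\<sigma>\<bar> = 1" "\<forall>s. \<gamma> s = ij.c (\<sigma> * s + \<tau>)"
    by (rule ij.arclength_parametrization_edge[OF par'(1)])
  obtain \<sigma>' \<tau>' where \<eta>: "\<bar>\<sigma>'\<bar> = 1" "\<forall>t. \<eta> t = kl.c (\<sigma>' * t + \<tau>')"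
    by (rule kl.arclength_parametrization_edge[OF par'(2)])
  have nz: "\<sigma> \<noteq> 0" "\<sigma>' \<noteq> 0" using \<gamma>(1) \<eta>(1) by auto
  \<comment> \<open>\<open>D\<close> is \<open>G\<close> after an affine change of each parameter
    with slope 1 or -1, so the critical point and the minimum are transported by the inverse of
    \<open>A\<close>.\<close>
  define A where "A z = (\<sigma> * fst z + \<tau>, \<sigma>' * snd z + \<tau>')" for z
  have D: "D = (\<lambda>z. G (A z))"
    by (auto simp: D_def G_def A_def \<gamma>(2)[rule_format] \<eta>(2)[rule_format] cosh_hdist[OF ij.edge_point_H3 kl.edge_point_H3])
  define s0 t0 where "s0 = (s - \<tau>) / \<sigma>" and "t0 = (t - \<tau>') / \<sigma>'"
  have A_iff: "A z = (s, t) \<longleftrightarrow> z = (s0, t0)" for z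
    using nz by (cases z) (auto simp: A_def s0_def t0_def field_simps)
  have A0: "A (s0, t0) = (s, t)" by (simp add: A_iff)
  have pts: "\<gamma> s0 = ij.c s" "\<eta> t0 = kl.c t"
    using A0 by (simp_all add: \<gamma>(2)[rule_format] \<eta>(2)[rule_format] A_def)
  have crit: "critical_point D z \<longleftrightarrow> z = (s0, t0)" for z
    unfolding D A_iff[symmetric] st(1)[rule_format, symmetric]
    unfolding A_def by (rule critical_point_affine[OF nz])
  show thesis
  proof (rule that[of s0 t0])
    show "\<forall>z. critical_point D z \<longleftrightarrow> z = (s0, t0)" using crit by blast
    show "\<forall>z. D (s0, t0) \<le> D z" unfolding D A0 using st(2) by blast
    show "D (s0, t0) = cosh (transversal_length P i j k l)"
      unfolding D A0 st(3,7) using st(8) by simp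
  qed (use st(3-6) in \<open>simp_all only: D A0 pts\<close>)
qed

end

section \<open>Relabelling the planes and bounds for realized tuples\<close>

lemma admissible_permute:
  assumes "admissible P H" and p: "\<And>i. i \<in> {1..4} \<Longrightarrow> p i \<in> {1..4}" "inj_on p {1..4}"
  shows "admissible (\<lambda>i. P (p i)) (\<lambda>i. H (p i))"
  unfolding admissible_def
proof (rule ballI)
  fix i :: nat assume i: "i \<in> {1..4}"
  have A: "hplane (P i) \<and> half H3 (P i) (H i) \<and>
    (\<forall>j\<in>{1..4} - {i}. P i \<inter> P j = {} \<and> \<not> parallel (P i) (P j) \<and> P j \<subseteq> H i)" if "i \<in> {1..4}" for i
    using assms(1) that unfolding admissible_def by blast
  have "p j \<in> {1..4} - {p i}" if "j \<in> {1..4} - {i}" for j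
    using that i p inj_onD[OF p(2), of j i] by blast
  then show "hplane (P (p i)) \<and> half H3 (P (p i)) (H (p i)) \<and>
    (\<forall>j\<in>{1..4} - {i}. P (p i) \<inter> P (p j) = {} \<and> \<not> parallel (P (p i)) (P (p j)) \<and> P (p j) \<subseteq> H (p i))"
    using A[OF p(1)[OF i]] by blast
qed

lemma realizedE:
  assumes "(x, y, a, b, c, d) \<in> realized"
  obtains P H i j k l where "admissible P H" "opposite_indices i j k l"
    "x = cosh (edge_length P i j)" "y = cosh (edge_length P k l)"
    "a = cosh (edge_length P i k)" "b = cosh (edge_length P i l)"
    "c = cosh (edge_length P j k)" "d = cosh (edge_length P j l)"
  using assms unfolding realized_def mem_Collect_eq prod.inject
  by (elim exE conjE) (rule that; assumption)

lemma realizedI: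
  assumes "admissible P H" "opposite_indices i j k l"
  shows "(cosh (edge_length P i j), cosh (edge_length P k l),
       cosh (edge_length P i k), cosh (edge_length P i l),
       cosh (edge_length P j k), cosh (edge_length P j l)) \<in> realized"
  unfolding realized_def mem_Collect_eq
  by (rule exI[of _ P], rule exI[of _ H], rule exI[of _ i], rule exI[of _ j], rule exI[of _ k],
      rule exI[of _ l]) (intro conjI refl assms)

text \<open>The exchange is carried out on the planes, by a transposition of the labels: exchanging
  the indices themselves would violate the order i < j, k < l in
  \<open>opposite_indices\<close>.\<close>

lemma realized_swap:
  assumes "(x, y, a, b, c, d) \<in> realized"
  shows "(x, y, b, a, d, c) \<in> realized" "(x, y, c, d, a, b) \<in> realized"
proof -
  obtain P H i j k l where r: "admissible P H" "opposite_indices i j k l"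
    "x = cosh (edge_length P i j)" "y = cosh (edge_length P k l)"
    "a = cosh (edge_length P i k)" "b = cosh (edge_length P i l)"
    "c = cosh (edge_length P j k)" "d = cosh (edge_length P j l)"
    using assms by (rule realizedE)
  note o = opposite_indicesD[OF r(2)]
  have adm: "admissible (\<lambda>m. P (Transposition.transpose u v m)) (\<lambda>m. H (Transposition.transpose u v m))"
    if "u \<in> {1..4}" "v \<in> {1..4}" for u v
  proof (rule admissible_permute[OF r(1)])
    show "Transposition.transpose u v m \<in> {1..4}" if "m \<in> {1..4}" for m
      using that \<open>u \<in> {1..4}\<close> \<open>v \<in> {1..4}\<close> unfolding Transposition.transpose_def by (simp split: if_split)
    show "inj_on (Transposition.transpose u v) {1..4}" by (rule inj_on_transpose)
  qed
  have e: "edge_length (\<lambda>m. P (Transposition.transpose p q m)) u v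
      = edge_length P (Transposition.transpose p q u) (Transposition.transpose p q v)" for p q u v
    by (simp add: edge_length_def)
  show "(x, y, b, a, d, c) \<in> realized"
    using realizedI[OF adm[OF o(3,4)] r(2)] o unfolding e r(3-8)
    by (simp add: Transposition.transpose_def edge_length_commute[of P l k])
  show "(x, y, c, d, a, b) \<in> realized"
    using realizedI[OF adm[OF o(1,2)] r(2)] o unfolding e r(3-8)
    by (simp add: Transposition.transpose_def edge_length_commute[of P j i])
qed

lemma realized_bounds:
  assumes "(x, y, a, b, c, d) \<in> realized"
  shows "a > 0" "b > 0" "c > 0" "d > 0" "transversal_cosh x y a b c d \<ge> 1"
proof -
  obtain P H i j k l where r: "admissible P H" "opposite_indices i j k l"
    "x = cosh (edge_length P i j)" "y = cosh (edge_length P k l)"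
    "a = cosh (edge_length P i k)" "b = cosh (edge_length P i l)"
    "c = cosh (edge_length P j k)" "d = cosh (edge_length P j l)"
    using assms by (rule realizedE)
  obtain n where "facing_normals P H n" using r(1) by (rule admissible_facing_normals)
  then interpret facing_planes P H n by unfold_locales
  show "a > 0" "b > 0" "c > 0" "d > 0" unfolding r by simp_all
  have "config_transversal_cosh P i j k l \<ge> 1" by (rule transversal[OF r(2)])
  then show "transversal_cosh x y a b c d \<ge> 1" unfolding r(3-8) config_transversal_cosh_def .
qed

text \<open>Lets a function of six numbers be evaluated at index pairs in either order, so that the
  minimum depends on the planes through their pairwise distances only. The last branch stands for
  {3, 4}.\<close>

definition pair_table :: "real \<Rightarrow> real \<Rightarrow> real \<Rightarrow> real \<Rightarrow> real \<Rightarrow> real \<Rightarrow> nat \<Rightarrow> nat \<Rightarrow> real" where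
  "pair_table e12 e13 e14 e23 e24 e34 i j =
     (if {i, j} = {1, 2} then e12 else if {i, j} = {1, 3} then e13 else if {i, j} = {1, 4} then e14
      else if {i, j} = {2, 3} then e23 else if {i, j} = {2, 4} then e24 else e34)"

lemma pair_table_edge_length:
  assumes "i \<in> {1..4}" "j \<in> {1..4}" "i \<noteq> j"
  shows "pair_table (edge_length P 1 2) (edge_length P 1 3) (edge_length P 1 4)
     (edge_length P 2 3) (edge_length P 2 4) (edge_length P 3 4) i j = edge_length P i j"
proof -
  have "i = 1 \<or> i = 2 \<or> i = 3 \<or> i = 4" "j = 1 \<or> j = 2 \<or> j = 3 \<or> j = 4"
    using assms by auto
  then show ?thesis
    using assms(3) edge_length_commute[of P 2 1] edge_length_commute[of P 3 1] edge_length_commute[of P 4 1]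
      edge_length_commute[of P 3 2] edge_length_commute[of P 4 2] edge_length_commute[of P 4 3]
    unfolding pair_table_def doubleton_eq_iff by (elim disjE) simp_all
qed

theorem lemma3p4:
  "\<exists>(F :: nat \<Rightarrow> nat \<Rightarrow> nat \<Rightarrow> nat \<Rightarrow> real \<Rightarrow> real \<Rightarrow> real \<Rightarrow> real \<Rightarrow> real \<Rightarrow> real \<Rightarrow> real)
    (T :: real \<Rightarrow> real \<Rightarrow> real \<Rightarrow> real \<Rightarrow> real \<Rightarrow> real \<Rightarrow> real).
    (\<forall>P H \<Delta> i j k l L\<^sub>i\<^sub>j L\<^sub>k\<^sub>l \<gamma> \<eta>.
       admissible P H \<and> truncated_tetrahedron P H \<Delta> \<and> opposite_indices i j k l \<and>
       common_perpendicular (P i) (P j) L\<^sub>i\<^sub>j \<and> common_perpendicular (P k) (P l) L\<^sub>k\<^sub>l \<and>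
       arclength_parametrization L\<^sub>i\<^sub>j \<gamma> \<and> arclength_parametrization L\<^sub>k\<^sub>l \<eta> \<longrightarrow>
       (let D = (\<lambda>(s, t). cosh (hdist (\<gamma> s) (\<eta> t))) in
        \<exists>s\<^sub>0 t\<^sub>0.
          critical_point D (s\<^sub>0, t\<^sub>0) \<and> (\<forall>z. critical_point D z \<longrightarrow> z = (s\<^sub>0, t\<^sub>0)) \<and>
          (\<forall>z. D (s\<^sub>0, t\<^sub>0) \<le> D z) \<and>
          D (s\<^sub>0, t\<^sub>0) =
            F i j k l (edge_length P 1 2) (edge_length P 1 3) (edge_length P 1 4)
                      (edge_length P 2 3) (edge_length P 2 4) (edge_length P 3 4) \<and>
          \<gamma> s\<^sub>0 \<in> \<Delta> \<and> \<eta> t\<^sub>0 \<in> \<Delta> \<and>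
          is_transversal P i j k l (\<gamma> s\<^sub>0) (\<eta> t\<^sub>0) \<and>
          D (s\<^sub>0, t\<^sub>0) = cosh (transversal_length P i j k l))) \<and>
    (\<forall>P H i j k l.
       admissible P H \<and> opposite_indices i j k l \<longrightarrow>
       transversal_length P i j k l =
         T (cosh (edge_length P i j)) (cosh (edge_length P k l))
           (cosh (edge_length P i k)) (cosh (edge_length P i l))
           (cosh (edge_length P j k)) (cosh (edge_length P j l))) \<and>
    (\<forall>x y a b c d. (x, y, a, b, c, d) \<in> realized \<longrightarrow>
       (x, y, b, a, d, c) \<in> realized \<and> T x y b a d c = T x y a b c d \<and>
       (x, y, c, d, a, b) \<in> realized \<and> T x y c d a b = T x y a b c d \<and>
       (x, y, d, c, b, a) \<in> realized \<and> T x y d c b a = T x y a b c d) \<and>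
    (\<forall>x>1. \<forall>y>1. \<forall>a b c d.
       strict_mono_on {a. (x, y, a, b, c, d) \<in> realized} (\<lambda>a. T x y a b c d) \<and>
       strict_mono_on {b. (x, y, a, b, c, d) \<in> realized} (\<lambda>b. T x y a b c d) \<and>
       strict_mono_on {c. (x, y, a, b, c, d) \<in> realized} (\<lambda>c. T x y a b c d) \<and>
       strict_mono_on {d. (x, y, a, b, c, d) \<in> realized} (\<lambda>d. T x y a b c d))"
proof -
  define T where "T x y a b c d = arcosh (transversal_cosh x y a b c d)" for x y a b c d
  define F where "F i j k l e12 e13 e14 e23 e24 e34 =
    (let e = pair_table e12 e13 e14 e23 e24 e34 in
       transversal_cosh (cosh (e i j)) (cosh (e k l)) (cosh (e i k)) (cosh (e i l)) (cosh (e j k)) (cosh (e j l)))"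
    for i j k l e12 e13 e14 e23 e24 e34
  have F: "F i j k l (edge_length P 1 2) (edge_length P 1 3) (edge_length P 1 4)
      (edge_length P 2 3) (edge_length P 2 4) (edge_length P 3 4) = config_transversal_cosh P i j k l"
    if "opposite_indices i j k l" for P i j k l
  proof -
    note o = opposite_indicesD[OF that]
    show ?thesis
      unfolding F_def Let_def config_transversal_cosh_def
        pair_table_edge_length[OF o(1,2,5)] pair_table_edge_length[OF o(3,4,6)]
        pair_table_edge_length[OF o(1,3,7)] pair_table_edge_length[OF o(1,4,8)]
        pair_table_edge_length[OF o(2,3,9)] pair_table_edge_length[OF o(2,4,10)] ..
  qed
  \<comment> \<open>Realizability of the smaller tuple supplies positivity and a value of at least
    1. The form with four weak inequalities and one strict one serves all four variables.\<close>
  have mono: "T x y a b c d < T x y a' b' c' d'"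
    if "x > 1" "y > 1" "(x, y, a, b, c, d) \<in> realized"
      "a \<le> a'" "b \<le> b'" "c \<le> c'" "d \<le> d'" "a < a' \<or> b < b' \<or> c < c' \<or> d < d'"
    for x y a b c d a' b' c' d'
    unfolding T_def
    by (rule arcosh_real_strict_mono[OF realized_bounds(5)[OF that(3)]
          transversal_cosh_less[OF that(1,2) realized_bounds(1-4)[OF that(3)] that(4-8)]])
  show ?thesis
  proof (rule exI[of _ F], rule exI[of _ T], intro conjI, goal_cases)
    case 1
    show ?case
    proof (intro allI impI, elim conjE, goal_cases)
      case (1 P H \<Delta> i j k l L L' \<gamma> \<eta>)
      note o = opposite_indicesD[OF 1(3)]
      obtain n where "facing_normals P H n" using 1(1) by (rule admissible_facing_normals)
      then interpret facing_planes P H n by unfold_locales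
      obtain s t where st: "\<forall>z. critical_point (\<lambda>(s, t). cosh (hdist (\<gamma> s) (\<eta> t))) z \<longleftrightarrow> z = (s, t)"
        "\<forall>z. (\<lambda>(s, t). cosh (hdist (\<gamma> s) (\<eta> t))) (s, t) \<le> (\<lambda>(s, t). cosh (hdist (\<gamma> s) (\<eta> t))) z"
        "(\<lambda>(s, t). cosh (hdist (\<gamma> s) (\<eta> t))) (s, t) = config_transversal_cosh P i j k l"
        "\<gamma> s \<in> internal_edge P i j" "\<eta> t \<in> internal_edge P k l"
        "is_transversal P i j k l (\<gamma> s) (\<eta> t)"
        "(\<lambda>(s, t). cosh (hdist (\<gamma> s) (\<eta> t))) (s, t) = cosh (transversal_length P i j k l)"
        by (rule transversal_parametrized[OF 1(3-7)])
      have \<Delta>: "\<gamma> s \<in> \<Delta>" "\<eta> t \<in> \<Delta>"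
        using internal_edge_truncated_tetrahedron[OF 1(2) o(1,2,5)]
          internal_edge_truncated_tetrahedron[OF 1(2) o(3,4,6)] st(4,5) by blast+
      have crit: "\<forall>z. critical_point (\<lambda>(s, t). cosh (hdist (\<gamma> s) (\<eta> t))) z \<longrightarrow> z = (s, t)"
        "critical_point (\<lambda>(s, t). cosh (hdist (\<gamma> s) (\<eta> t))) (s, t)"
        by (intro allI impI st(1)[rule_format, THEN iffD1])
          (assumption, rule st(1)[rule_format, THEN iffD2, OF refl])
      show ?case
        unfolding Let_def F[OF 1(3)]
        by (rule exI[of _ s], rule exI[of _ t]) (intro conjI crit st(2,3,6,7) \<Delta>)
    qed
  next
    case 2
    show ?case
    proof (intro allI impI, elim conjE, goal_cases)
      case (1 P H i j k l)
      obtain n where "facing_normals P H n" using 1(1) by (rule admissible_facing_normals)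
      then interpret facing_planes P H n by unfold_locales
      have "transversal_length P i j k l = arcosh (config_transversal_cosh P i j k l)"
        by (rule transversal[OF 1(2)])
      then show ?case by (simp only: T_def config_transversal_cosh_def)
    qed
  next
    case 3
    have T_swap: "T x y b a d c = T x y a b c d" "T x y c d a b = T x y a b c d" for x y a b c d
      unfolding T_def by (rule arg_cong[OF transversal_cosh_swap(1)], rule arg_cong[OF transversal_cosh_swap(2)])
    show ?case
    proof (intro allI impI conjI, goal_cases)
      case (1 x y a b c d)
      then show ?case by (rule realized_swap(1))
    next
      case (2 x y a b c d)
      show ?case by (rule T_swap(1))
    next
      case (3 x y a b c d)
      then show ?case by (rule realized_swap(2))
    next
      case (4 x y a b c d)
      show ?case by (rule T_swap(2))
    next
      \<comment> \<open>The third even involution is the product of the other two.\<close>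
      case (5 x y a b c d)
      then show ?case by (rule realized_swap(2)[OF realized_swap(1)])
    next
      case (6 x y a b c d)
      show ?case by (rule trans[OF T_swap(1) T_swap(2)])
    qed
  next
    case 4
    show ?case
    proof (intro allI impI conjI strict_mono_onI, unfold mem_Collect_eq)
    qed (rule mono; simp)+
  qed
qed

end
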